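(* Let $\Gamma$ be a discrete group, let $X,Y$ be $\Gamma$-spaces, and let $\pi:X\to Y$ be a continuous $\Gamma$-equivariant surjection. Suppose that there exists a subgroup $H\le\Gamma$ such that $H\curvearrowright X$ is minimal and $H$ is $Y$-plump. Then every intermediate $C^*$-algebra $\mathcal A$ with $C(Y)\rtimes_r H\subseteq\mathcal A\subseteq C(X)\rtimes_r\Gamma$ is simple.
   Context: A $\Gamma$-space is a nonempty compact Hausdorff space with an action of the discrete group $\Gamma$ by homeomorphisms; an action is minimal if every orbit is dense. $C(X)\rtimes_r\Gamma$ denotes the reduced crossed product, $\lambda(s)$ ($s\in\Gamma$) the canonical unitaries, and $\mathbb E:C(X)\rtimes_r\Gamma\to C(X)$ the canonical conditional expectation ($\mathbb E(f\lambda(s))=f$ if $s=e$ and $0$ otherwise). $C(Y)\rtimes_r H$ is viewed as a subalgebra of $C(X)\rtimes_r\Gamma$ via $f\mapsto f\circ\pi$ and $H\le\Gamma$. For a $\Gamma$-space $Y$, a subgroup $H\le\Gamma$ is called $Y$-plump if for every $\varepsilon>0$ and every $a\in C(Y)\rtimes_r\Gamma$ there are $s_1,\dots,s_m\in H$ and nonnegative $g_1,\dots,g_m\in C(Y)$ with $\sum_{j=1}^m g_j^2=1$ such that $\bigl\|\sum_{j=1}^m g_j\lambda(s_j)a\lambda(s_j)^*g_j-\mathbb E(a)\bigr\|<\varepsilon$ (with $\mathbb E$ here the canonical expectation onto $C(Y)$). *)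

theory Defs
  imports "HOL-Analysis.Analysis" "HOL-Algebra.Group_Action"
begin

typedef 'i ell2 = "{f :: 'i \<Rightarrow> complex. (\<lambda>i. (cmod (f i))\<^sup>2) summable_on UNIV}"
  morphisms coord ell2_of
  by (rule exI[of _ "\<lambda>_. 0"]) simp

lemma coord_summable: "(\<lambda>i. (cmod (coord \<xi> i))\<^sup>2) summable_on UNIV"
  using coord[of \<xi>] by simp

lemma coord_ell2_of:
  "(\<lambda>i. (cmod (f i))\<^sup>2) summable_on UNIV \<Longrightarrow> coord (ell2_of f) = f"
  by (simp add: ell2_of_inverse)

lemma ell2_eqI: "(\<And>i. coord \<xi> i = coord \<eta> i) \<Longrightarrow> \<xi> = \<eta>"
  by (metis coord_inject ext)

lemma square_summable_add:
  fixes f g :: "'i \<Rightarrow> complex"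
  assumes "(\<lambda>i. (cmod (f i))\<^sup>2) summable_on UNIV" "(\<lambda>i. (cmod (g i))\<^sup>2) summable_on UNIV"
  shows "(\<lambda>i. (cmod (f i + g i))\<^sup>2) summable_on UNIV"
proof (rule summable_on_comparison_test)
  show "(\<lambda>i. 2 * (cmod (f i))\<^sup>2 + 2 * (cmod (g i))\<^sup>2) summable_on UNIV"
    by (intro summable_on_add summable_on_cmult_right assms)
  show "(cmod (f i + g i))\<^sup>2 \<le> 2 * (cmod (f i))\<^sup>2 + 2 * (cmod (g i))\<^sup>2" for i
  proof -
    have "(cmod (f i + g i))\<^sup>2 \<le> (cmod (f i) + cmod (g i))\<^sup>2"
      by (intro power_mono norm_triangle_ineq) simp
    also have "\<dots> \<le> 2 * (cmod (f i))\<^sup>2 + 2 * (cmod (g i))\<^sup>2"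
      using zero_le_power2[of "cmod (f i) - cmod (g i)"] by (simp add: power2_eq_square algebra_simps)
    finally show ?thesis .
  qed
qed auto

lemma square_summable_cmult:
  fixes f :: "'i \<Rightarrow> complex"
  assumes "(\<lambda>i. (cmod (f i))\<^sup>2) summable_on UNIV"
  shows "(\<lambda>i. (cmod (c * f i))\<^sup>2) summable_on UNIV"
  using summable_on_cmult_right[OF assms, of "(cmod c)\<^sup>2"]
  by (simp add: norm_mult power_mult_distrib)

definition cinner :: "'i ell2 \<Rightarrow> 'i ell2 \<Rightarrow> complex" where
  "cinner \<xi> \<eta> = (\<Sum>\<^sub>\<infinity>i. coord \<xi> i * cnj (coord \<eta> i))"

definition cscale :: "complex \<Rightarrow> 'i ell2 \<Rightarrow> 'i ell2" where
  "cscale c \<xi> = ell2_of (\<lambda>i. c * coord \<xi> i)"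

lemma coord_cscale: "coord (cscale c \<xi>) i = c * coord \<xi> i"
  unfolding cscale_def by (subst coord_ell2_of) (auto intro: square_summable_cmult coord_summable)

lemma cinner_summable: "(\<lambda>i. coord \<xi> i * cnj (coord \<eta> i)) summable_on UNIV"
proof (rule abs_summable_summable, rule summable_on_comparison_test)
  show "(\<lambda>i. (cmod (coord \<xi> i))\<^sup>2 + (cmod (coord \<eta> i))\<^sup>2) summable_on UNIV"
    by (intro summable_on_add coord_summable)
  show "norm (coord \<xi> i * cnj (coord \<eta> i)) \<le> (cmod (coord \<xi> i))\<^sup>2 + (cmod (coord \<eta> i))\<^sup>2" for i
  proof -
    have "2 * (cmod (coord \<xi> i) * cmod (coord \<eta> i)) \<le> (cmod (coord \<xi> i))\<^sup>2 + (cmod (coord \<eta> i))\<^sup>2"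
      using sum_squares_bound[of "cmod (coord \<xi> i)" "cmod (coord \<eta> i)"] by simp
    moreover have "0 \<le> cmod (coord \<xi> i) * cmod (coord \<eta> i)" by simp
    ultimately show ?thesis by (simp only: norm_mult complex_mod_cnj)
  qed
qed auto

instantiation ell2 :: (type) real_inner
begin

definition zero_ell2 :: "'a ell2" where
  "zero_ell2 = ell2_of (\<lambda>_. 0)"
definition plus_ell2 :: "'a ell2 \<Rightarrow> 'a ell2 \<Rightarrow> 'a ell2" where
  "plus_ell2 \<xi> \<eta> = ell2_of (\<lambda>i. coord \<xi> i + coord \<eta> i)"
definition uminus_ell2 :: "'a ell2 \<Rightarrow> 'a ell2" where
  "uminus_ell2 \<xi> = ell2_of (\<lambda>i. - coord \<xi> i)"
definition minus_ell2 :: "'a ell2 \<Rightarrow> 'a ell2 \<Rightarrow> 'a ell2" where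
  "minus_ell2 \<xi> \<eta> = ell2_of (\<lambda>i. coord \<xi> i - coord \<eta> i)"
definition scaleR_ell2 :: "real \<Rightarrow> 'a ell2 \<Rightarrow> 'a ell2" where
  "scaleR_ell2 r \<xi> = ell2_of (\<lambda>i. complex_of_real r * coord \<xi> i)"
definition inner_ell2 :: "'a ell2 \<Rightarrow> 'a ell2 \<Rightarrow> real" where
  "inner_ell2 \<xi> \<eta> = Re (cinner \<xi> \<eta>)"
definition norm_ell2 :: "'a ell2 \<Rightarrow> real" where
  "norm_ell2 \<xi> = sqrt (\<Sum>\<^sub>\<infinity>i. (cmod (coord \<xi> i))\<^sup>2)"
definition sgn_ell2 :: "'a ell2 \<Rightarrow> 'a ell2" where
  "sgn_ell2 \<xi> = inverse (norm \<xi>) *\<^sub>R \<xi>"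
definition dist_ell2 :: "'a ell2 \<Rightarrow> 'a ell2 \<Rightarrow> real" where
  "dist_ell2 \<xi> \<eta> = norm (\<xi> - \<eta>)"
definition [code del]:
  "(uniformity :: ('a ell2 \<times> 'a ell2) filter) = (INF e\<in>{0<..}. principal {(x, y). dist x y < e})"
definition [code del]:
  "open (U :: 'a ell2 set) \<longleftrightarrow> (\<forall>x\<in>U. \<forall>\<^sub>F (x', y) in uniformity. x' = x \<longrightarrow> y \<in> U)"

lemma coord_zero: "coord (0 :: 'a ell2) i = 0"
  by (simp add: zero_ell2_def coord_ell2_of)

lemma coord_add: "coord (\<xi> + \<eta> :: 'a ell2) i = coord \<xi> i + coord \<eta> i"
  unfolding plus_ell2_def by (subst coord_ell2_of) (auto intro: square_summable_add coord_summable)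

lemma coord_uminus: "coord (- \<xi> :: 'a ell2) i = - coord \<xi> i"
  unfolding uminus_ell2_def by (subst coord_ell2_of) (auto intro: coord_summable)

lemma coord_minus: "coord (\<xi> - \<eta> :: 'a ell2) i = coord \<xi> i - coord \<eta> i"
proof -
  have "\<xi> - \<eta> = \<xi> + - \<eta>"
    by (simp add: minus_ell2_def plus_ell2_def coord_uminus)
  thus ?thesis by (simp add: coord_add coord_uminus)
qed

lemma coord_scaleR: "coord (r *\<^sub>R \<xi> :: 'a ell2) i = complex_of_real r * coord \<xi> i"
  unfolding scaleR_ell2_def
  by (subst coord_ell2_of) (auto intro: square_summable_cmult coord_summable)

lemma cinner_self: "cinner \<xi> \<xi> = complex_of_real (\<Sum>\<^sub>\<infinity>i. (cmod (coord \<xi> i))\<^sup>2)"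
proof -
  have "cinner \<xi> \<xi> = (\<Sum>\<^sub>\<infinity>i. complex_of_real ((cmod (coord \<xi> i))\<^sup>2))"
    unfolding cinner_def by (intro infsum_cong) (simp only: complex_norm_square)
  also have "\<dots> = complex_of_real (\<Sum>\<^sub>\<infinity>i. (cmod (coord \<xi> i))\<^sup>2)"
    by (intro infsumI has_sum_of_real has_sum_infsum coord_summable)
  finally show ?thesis .
qed

lemma cinner_add_left: "cinner (\<xi> + \<xi>' :: 'a ell2) \<eta> = cinner \<xi> \<eta> + cinner \<xi>' \<eta>"
  unfolding cinner_def
  by (simp add: coord_add distrib_right infsum_add[OF cinner_summable cinner_summable])

lemma cinner_cscale_left: "cinner (cscale c \<xi>) \<eta> = c * cinner \<xi> \<eta>"
  unfolding cinner_def by (simp add: coord_cscale mult.assoc infsum_cmult_right')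

lemma cinner_commute: "cinner \<xi> \<eta> = cnj (cinner \<eta> \<xi>)"
  unfolding cinner_def infsum_cnj[symmetric] by (simp add: mult.commute)

lemma scaleR_eq_cscale: "r *\<^sub>R (\<xi> :: 'a ell2) = cscale (complex_of_real r) \<xi>"
  by (rule ell2_eqI) (simp add: coord_scaleR coord_cscale)

instance
proof
  fix a b c :: "'a ell2" and r t :: real
  show "a + b + c = a + (b + c)" "a + b = b + a" "0 + a = a" "- a + a = 0" "a - b = a + - b"
    "r *\<^sub>R (a + b) = r *\<^sub>R a + r *\<^sub>R b" "(r + t) *\<^sub>R a = r *\<^sub>R a + t *\<^sub>R a"
    "r *\<^sub>R t *\<^sub>R a = (r * t) *\<^sub>R a" "1 *\<^sub>R a = a"
    by (auto intro!: ell2_eqI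
        simp: coord_add coord_zero coord_uminus coord_minus coord_scaleR algebra_simps)
  show "sgn a = inverse (norm a) *\<^sub>R a" "dist a b = norm (a - b)"
    by (simp_all add: sgn_ell2_def dist_ell2_def)
  show "(uniformity :: ('a ell2 \<times> 'a ell2) filter) = (INF e\<in>{0<..}. principal {(x, y). dist x y < e})"
    by (rule uniformity_ell2_def)
  show "open U \<longleftrightarrow> (\<forall>x\<in>U. \<forall>\<^sub>F (x', y) in uniformity. x' = x \<longrightarrow> y \<in> U)" for U :: "'a ell2 set"
    by (rule open_ell2_def)
  show "a \<bullet> b = b \<bullet> a"
    by (simp add: inner_ell2_def cinner_commute[of a b])
  show "(a + b) \<bullet> c = a \<bullet> c + b \<bullet> c"
    by (simp add: inner_ell2_def cinner_add_left)
  show "r *\<^sub>R a \<bullet> b = r * (a \<bullet> b)"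
    by (simp add: inner_ell2_def scaleR_eq_cscale cinner_cscale_left)
  have self: "a \<bullet> a = (\<Sum>\<^sub>\<infinity>i. (cmod (coord a i))\<^sup>2)"
    by (simp add: inner_ell2_def cinner_self)
  show "0 \<le> a \<bullet> a"
    unfolding self by (rule infsum_nonneg) simp
  show "a \<bullet> a = 0 \<longleftrightarrow> a = 0"
  proof
    assume "a \<bullet> a = 0"
    hence "(cmod (coord a i))\<^sup>2 = 0" for i
      using nonneg_infsum_le_0D[of "\<lambda>i. (cmod (coord a i))\<^sup>2" UNIV i] coord_summable[of a] self
      by simp
    thus "a = 0" by (intro ell2_eqI) (simp add: coord_zero)
  next
    assume "a = 0"
    hence "coord a i = 0" for i by (simp only: coord_zero)
    thus "a \<bullet> a = 0" by (simp add: self)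
  qed
  show "norm a = sqrt (a \<bullet> a)"
    by (simp add: self norm_ell2_def)
qed

end

lemma norm_ell2_square: "(norm \<xi>)\<^sup>2 = (\<Sum>\<^sub>\<infinity>i. (cmod (coord \<xi> i))\<^sup>2)"
  unfolding norm_ell2_def by (simp add: infsum_nonneg)

definition ket :: "'i \<Rightarrow> 'i ell2" where
  "ket i = ell2_of (\<lambda>j. if j = i then 1 else 0)"

lemma coord_ket: "coord (ket i) j = (if j = i then 1 else 0)"
proof -
  have "(\<lambda>_. 1 :: real) summable_on {i}" by simp
  also have "?this \<longleftrightarrow> (\<lambda>j. (cmod (if j = i then 1 else 0))\<^sup>2) summable_on UNIV"
    by (rule summable_on_cong_neutral) auto
  finally have "(\<lambda>j. (cmod (if j = i then 1 else 0))\<^sup>2) summable_on UNIV" .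
  thus ?thesis unfolding ket_def by (simp add: coord_ell2_of)
qed

lemma norm_ket: "norm (ket i) = 1"
proof -
  have "(\<Sum>\<^sub>\<infinity>j. (cmod (coord (ket i) j))\<^sup>2) = (\<Sum>\<^sub>\<infinity>j\<in>{i}. 1)"
    by (rule infsum_cong_neutral) (auto simp: coord_ket)
  thus ?thesis by (simp add: norm_ell2_def)
qed

lemma cmod_coord_le: "cmod (coord \<xi> i) \<le> norm \<xi>"
proof -
  have "(\<Sum>j\<in>{i}. (cmod (coord \<xi> j))\<^sup>2) \<le> (\<Sum>\<^sub>\<infinity>j. (cmod (coord \<xi> j))\<^sup>2)"
    by (rule finite_sum_le_infsum[OF coord_summable]) auto
  hence "(cmod (coord \<xi> i))\<^sup>2 \<le> (norm \<xi>)\<^sup>2"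
    by (simp add: norm_ell2_square)
  thus ?thesis by (rule power2_le_imp_le) simp
qed

lemma bounded_linear_weighted_comp:
  fixes c :: "'i \<Rightarrow> complex"
  assumes inj: "inj_on \<sigma> I" and B: "\<forall>i\<in>I. cmod (c i) \<le> B"
  defines "T \<equiv> \<lambda>f i. if i \<in> I then c i * f (\<sigma> i) else 0"
  shows "bounded_linear (\<lambda>\<xi>. ell2_of (T (coord \<xi>)))" (is ?lin)
    and "coord (ell2_of (T (coord \<xi>))) = T (coord \<xi>)" (is ?coord)
proof -
  have sum_comp: "(\<lambda>i. (cmod (coord \<xi> (\<sigma> i)))\<^sup>2) summable_on I" for \<xi>
  proof -
    have "(\<lambda>i. (cmod (coord \<xi> i))\<^sup>2) summable_on (\<sigma> ` I)"
      by (rule summable_on_subset_banach[OF coord_summable]) simp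
    thus ?thesis by (simp add: summable_on_reindex[OF inj] o_def)
  qed
  have bnd: "(cmod (T (coord \<xi>) i))\<^sup>2 \<le> B\<^sup>2 * (cmod (coord \<xi> (\<sigma> i)))\<^sup>2" if "i \<in> I" for \<xi> i
    using B[rule_format, OF that] that
    by (auto simp: T_def norm_mult power_mult_distrib intro!: mult_right_mono power_mono)
  have s1: "(\<lambda>i. (cmod (T (coord \<xi>) i))\<^sup>2) summable_on I" for \<xi>
    by (rule summable_on_comparison_test[OF summable_on_cmult_right[OF sum_comp[of \<xi>], of "B\<^sup>2"]])
      (auto intro: bnd)
  have s2: "(\<lambda>i. (cmod (T (coord \<xi>) i))\<^sup>2) summable_on UNIV" for \<xi>
    by (rule summable_on_cong_neutral[THEN iffD1, OF _ _ _ s1]) (auto simp: T_def)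
  have co: "coord (ell2_of (T (coord \<xi>))) = T (coord \<xi>)" for \<xi>
    by (rule coord_ell2_of[OF s2])
  have nb: "norm (ell2_of (T (coord \<xi>))) \<le> norm \<xi> * \<bar>B\<bar>" for \<xi>
  proof -
    have "(norm (ell2_of (T (coord \<xi>))))\<^sup>2 = (\<Sum>\<^sub>\<infinity>i. (cmod (T (coord \<xi>) i))\<^sup>2)"
      by (simp add: norm_ell2_square co)
    also have "\<dots> = (\<Sum>\<^sub>\<infinity>i\<in>I. (cmod (T (coord \<xi>) i))\<^sup>2)"
      by (rule infsum_cong_neutral) (auto simp: T_def)
    also have "\<dots> \<le> (\<Sum>\<^sub>\<infinity>i\<in>I. B\<^sup>2 * (cmod (coord \<xi> (\<sigma> i)))\<^sup>2)"
      by (intro infsum_mono s1 summable_on_cmult_right sum_comp bnd)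
    also have "\<dots> = B\<^sup>2 * (\<Sum>\<^sub>\<infinity>i\<in>I. (cmod (coord \<xi> (\<sigma> i)))\<^sup>2)"
      by (simp add: infsum_cmult_right')
    also have "\<dots> = B\<^sup>2 * (\<Sum>\<^sub>\<infinity>i\<in>\<sigma> ` I. (cmod (coord \<xi> i))\<^sup>2)"
      by (simp add: infsum_reindex[OF inj] o_def)
    also have "\<dots> \<le> B\<^sup>2 * (\<Sum>\<^sub>\<infinity>i. (cmod (coord \<xi> i))\<^sup>2)"
      by (intro mult_left_mono infsum_mono_neutral)
        (auto intro: coord_summable summable_on_subset_banach[OF coord_summable])
    also have "\<dots> = (norm \<xi> * \<bar>B\<bar>)\<^sup>2"
      by (simp add: norm_ell2_square power_mult_distrib)
    finally have "(norm (ell2_of (T (coord \<xi>))))\<^sup>2 \<le> (norm \<xi> * \<bar>B\<bar>)\<^sup>2" .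
    thus ?thesis by (rule power2_le_imp_le) simp
  qed
  show ?lin
  proof (rule bounded_linear_intro[OF _ _ nb])
    show "ell2_of (T (coord (\<xi> + \<eta>))) = ell2_of (T (coord \<xi>)) + ell2_of (T (coord \<eta>))" for \<xi> \<eta>
      by (rule ell2_eqI, simp only: co coord_add)
        (simp add: T_def coord_add algebra_simps)
    show "ell2_of (T (coord (r *\<^sub>R \<xi>))) = r *\<^sub>R ell2_of (T (coord \<xi>))" for r \<xi>
      by (rule ell2_eqI, simp only: co coord_scaleR)
        (simp add: T_def coord_scaleR algebra_simps)
  qed
  show ?coord by (rule co)
qed

type_synonym 'i operator = "'i ell2 \<Rightarrow>\<^sub>L 'i ell2"

text \<open>Library bounded operators are only real-linear.  The complex structure enters through
  \<open>cscale_op\<close>; all elements of the crossed products below are complex-linear.\<close>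

definition cscale_op :: "complex \<Rightarrow> 'i operator \<Rightarrow> 'i operator" where
  "cscale_op c T = Blinfun (\<lambda>\<xi>. cscale c (T \<xi>))"

definition adj_op :: "'i operator \<Rightarrow> 'i operator" where
  "adj_op T = (THE S :: 'i operator. \<forall>\<xi> \<eta>. cinner (T \<xi>) \<eta> = cinner \<xi> (S \<eta>))"

definition complex_subspace :: "'i operator set \<Rightarrow> bool" where
  "complex_subspace A \<longleftrightarrow>
    0 \<in> A \<and> (\<forall>a\<in>A. \<forall>b\<in>A. a + b \<in> A) \<and> (\<forall>c. \<forall>a\<in>A. cscale_op c a \<in> A)"

definition cstar_algebra :: "'i operator set \<Rightarrow> bool" where
  "cstar_algebra A \<longleftrightarrow>
    complex_subspace A \<and> (\<forall>a\<in>A. \<forall>b\<in>A. a o\<^sub>L b \<in> A) \<and> (\<forall>a\<in>A. adj_op a \<in> A) \<and> closed A"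

definition closed_ideal :: "'i operator set \<Rightarrow> 'i operator set \<Rightarrow> bool" where
  "closed_ideal I A \<longleftrightarrow>
    I \<subseteq> A \<and> complex_subspace I \<and> (\<forall>a\<in>A. \<forall>b\<in>I. a o\<^sub>L b \<in> I \<and> b o\<^sub>L a \<in> I) \<and> closed I"

definition simple_cstar_algebra :: "'i operator set \<Rightarrow> bool" where
  "simple_cstar_algebra A \<longleftrightarrow>
    cstar_algebra A \<and> A \<noteq> {0} \<and> (\<forall>I. closed_ideal I A \<longrightarrow> I = {0} \<or> I = A)"

lemma cscale_op_apply: "blinfun_apply (cscale_op c T) \<xi> = cscale c (T \<xi>)"
proof -
  have "bounded_linear (\<lambda>\<xi>. cscale c \<xi> :: 'a ell2)"
    using bounded_linear_weighted_comp(1)[of id UNIV "\<lambda>_. c" "cmod c"] by (simp add: cscale_def)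
  hence "bounded_linear (\<lambda>\<xi>. cscale c (T \<xi>))"
    by (rule bounded_linear_compose) (rule blinfun.bounded_linear_right)
  thus ?thesis by (simp add: cscale_op_def bounded_linear_Blinfun_apply)
qed

lemma adj_op_eqI:
  assumes "\<And>\<xi> \<eta>. cinner (blinfun_apply T \<xi>) \<eta> = cinner \<xi> (blinfun_apply S \<eta>)"
  shows "adj_op T = S"
  unfolding adj_op_def
proof (rule the_equality)
  show "\<forall>\<xi> \<eta>. cinner (T \<xi>) \<eta> = cinner \<xi> (S \<eta>)" using assms by blast
  fix S' assume S': "\<forall>\<xi> \<eta>. cinner (T \<xi>) \<eta> = cinner \<xi> (blinfun_apply S' \<eta>)"
  show "S' = S"
  proof (rule blinfun_eqI)
    fix \<eta>
    have "\<xi> \<bullet> S' \<eta> = \<xi> \<bullet> S \<eta>" for \<xi>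
      using S' assms by (simp add: inner_ell2_def)
    thus "S' \<eta> = S \<eta>" by (rule vector_eq_ldot[THEN iffD1, OF allI])
  qed
qed

definition Gamma_space :: "('g, 'm) monoid_scheme \<Rightarrow> 'x topology \<Rightarrow> ('g \<Rightarrow> 'x \<Rightarrow> 'x) \<Rightarrow> bool" where
  "Gamma_space G X \<phi> \<longleftrightarrow>
    topspace X \<noteq> {} \<and> compact_space X \<and> Hausdorff_space X \<and>
    group_action G (topspace X) \<phi> \<and> (\<forall>g\<in>carrier G. homeomorphic_map X X (\<phi> g))"

definition minimal_action :: "('g, 'm) monoid_scheme \<Rightarrow> 'x topology \<Rightarrow> ('g \<Rightarrow> 'x \<Rightarrow> 'x) \<Rightarrow> bool" where
  "minimal_action G X \<phi> \<longleftrightarrow> (\<forall>x\<in>topspace X. X closure_of (orbit G \<phi> x) = topspace X)"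

definition cfuns :: "'x topology \<Rightarrow> ('x \<Rightarrow> complex) set" where
  "cfuns X = {f. continuous_map X euclidean f}"

text \<open>The regular representation induced from the faithful representation of \<open>C(X)\<close> by
  multiplication operators on square-summable families over \<open>X\<close>.  It lives on the families
  supported on \<open>carrier G \<times> topspace X\<close>; on the orthogonal complement, which is nonzero
  if the carriers are not the whole types, all operators are extended by \<open>0\<close>.  Accordingly the
  unit of the crossed product is the projection \<open>fun_op G X \<phi> (\<lambda>_. 1)\<close>.
  Since \<open>s\<cdot>f = f \<circ> \<phi> (inv s)\<close>, the function \<open>f\<close> acts on the fibre over \<open>t\<close> by
  \<open>t\<^sup>-\<^sup>1\<cdot>f = f \<circ> \<phi> t\<close>.\<close>

definition fun_op :: "('g, 'm) monoid_scheme \<Rightarrow> 'x topology \<Rightarrow> ('g \<Rightarrow> 'x \<Rightarrow> 'x) \<Rightarrow>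
    ('x \<Rightarrow> complex) \<Rightarrow> ('g \<times> 'x) operator" where
  "fun_op G X \<phi> f = Blinfun (\<lambda>\<xi>. ell2_of (\<lambda>(t, x).
    if t \<in> carrier G \<and> x \<in> topspace X then f (\<phi> t x) * coord \<xi> (t, x) else 0))"

definition lambda_op :: "('g, 'm) monoid_scheme \<Rightarrow> 'x topology \<Rightarrow> 'g \<Rightarrow> ('g \<times> 'x) operator" where
  "lambda_op G X s = Blinfun (\<lambda>\<xi>. ell2_of (\<lambda>(t, x).
    if t \<in> carrier G \<and> x \<in> topspace X then coord \<xi> (inv\<^bsub>G\<^esub> s \<otimes>\<^bsub>G\<^esub> t, x) else 0))"

text \<open>The closed linear span of the \<open>f \<lambda>(s)\<close> with \<open>f \<in> F\<close> and \<open>s \<in> S\<close>, where \<open>F\<close> is a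
  linear space of functions.\<close>

definition crossed_span :: "('g, 'm) monoid_scheme \<Rightarrow> 'x topology \<Rightarrow> ('g \<Rightarrow> 'x \<Rightarrow> 'x) \<Rightarrow>
    ('x \<Rightarrow> complex) set \<Rightarrow> 'g set \<Rightarrow> ('g \<times> 'x) operator set" where
  "crossed_span G X \<phi> F S = closure {\<Sum>s\<in>K. fun_op G X \<phi> (f s) o\<^sub>L lambda_op G X s | K f.
    finite K \<and> K \<subseteq> S \<and> (\<forall>s\<in>K. f s \<in> F)}"

definition reduced_crossed_product :: "('g, 'm) monoid_scheme \<Rightarrow> 'x topology \<Rightarrow>
    ('g \<Rightarrow> 'x \<Rightarrow> 'x) \<Rightarrow> ('g \<times> 'x) operator set" where
  "reduced_crossed_product G X \<phi> = crossed_span G X \<phi> (cfuns X) (carrier G)"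

text \<open>The image of \<open>C(Y) \<rtimes>\<^sub>r H\<close> in \<open>C(X) \<rtimes>\<^sub>r G\<close> under the canonical embedding
  \<open>f \<lambda>(h) \<mapsto> (f \<circ> \<pi>) \<lambda>(h)\<close>; this map is isometric, so the image is the closed span of the
  images of the generators.\<close>

definition embedded_crossed_product :: "('g, 'm) monoid_scheme \<Rightarrow> 'x topology \<Rightarrow>
    ('g \<Rightarrow> 'x \<Rightarrow> 'x) \<Rightarrow> 'y topology \<Rightarrow> ('x \<Rightarrow> 'y) \<Rightarrow> 'g set \<Rightarrow> ('g \<times> 'x) operator set" where
  "embedded_crossed_product G X \<phi> Y \<pi> H = crossed_span G X \<phi> ((\<lambda>f. f \<circ> \<pi>) ` cfuns Y) H"

text \<open>The canonical conditional expectation, as a function on \<open>X\<close>: the diagonal matrix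
  coefficients over the neutral element.\<close>

definition cond_exp :: "('g, 'm) monoid_scheme \<Rightarrow> ('g \<times> 'x) operator \<Rightarrow> 'x \<Rightarrow> complex" where
  "cond_exp G a = (\<lambda>x. coord (a (ket (\<one>\<^bsub>G\<^esub>, x))) (\<one>\<^bsub>G\<^esub>, x))"

definition plump :: "('g, 'm) monoid_scheme \<Rightarrow> 'y topology \<Rightarrow> ('g \<Rightarrow> 'y \<Rightarrow> 'y) \<Rightarrow> 'g set \<Rightarrow> bool" where
  "plump G Y \<psi> H \<longleftrightarrow>
    (\<forall>\<epsilon>>0. \<forall>a\<in>reduced_crossed_product G Y \<psi>.
      \<exists>(m::nat) (s :: nat \<Rightarrow> 'g) (g :: nat \<Rightarrow> 'y \<Rightarrow> real).
        (\<forall>j<m. s j \<in> H \<and> continuous_map Y euclideanreal (g j) \<and> (\<forall>y\<in>topspace Y. 0 \<le> g j y)) \<and>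
        (\<forall>y\<in>topspace Y. (\<Sum>j<m. (g j y)\<^sup>2) = 1) \<and>
        norm ((\<Sum>j<m. fun_op G Y \<psi> (\<lambda>y. complex_of_real (g j y)) o\<^sub>L lambda_op G Y (s j) o\<^sub>L a o\<^sub>L
            adj_op (lambda_op G Y (s j)) o\<^sub>L fun_op G Y \<psi> (\<lambda>y. complex_of_real (g j y)))
          - fun_op G Y \<psi> (cond_exp G a)) < \<epsilon>)"

lemma coord_fun_op:
  assumes X: "group_action G (topspace X) \<phi>"
    and B: "\<And>x. x \<in> topspace X \<Longrightarrow> cmod (f x) \<le> B"
  shows "coord (fun_op G X \<phi> f \<xi>) (t, x) =
    (if t \<in> carrier G \<and> x \<in> topspace X then f (\<phi> t x) * coord \<xi> (t, x) else 0)"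
proof -
  let ?I = "carrier G \<times> topspace X"
  have *: "\<forall>i\<in>?I. cmod (f (\<phi> (fst i) (snd i))) \<le> B"
    using group_action.surj_prop[OF X] by (auto intro!: B)
  have eq: "(\<lambda>(t, x). if t \<in> carrier G \<and> x \<in> topspace X then f (\<phi> t x) * h (t, x) else 0)
      = (\<lambda>i. if i \<in> ?I then f (\<phi> (fst i) (snd i)) * h (id i) else 0)" for h
    by (auto simp: fun_eq_iff)
  note b = bounded_linear_weighted_comp[of id ?I "\<lambda>i. f (\<phi> (fst i) (snd i))" B, OF inj_on_id *]
  show ?thesis
    unfolding fun_op_def eq bounded_linear_Blinfun_apply[OF b(1)] b(2) by simp
qed

lemma coord_lambda_op:
  fixes G :: "('g, 'm) monoid_scheme" and X :: "'x topology"
  assumes "group G" "s \<in> carrier G"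
  shows "coord (lambda_op G X s \<xi>) (t, x) =
    (if t \<in> carrier G \<and> x \<in> topspace X then coord \<xi> (inv\<^bsub>G\<^esub> s \<otimes>\<^bsub>G\<^esub> t, x) else 0)"
proof -
  let ?I = "carrier G \<times> topspace X" and ?\<sigma> = "\<lambda>i :: 'g \<times> 'x. (inv\<^bsub>G\<^esub> s \<otimes>\<^bsub>G\<^esub> fst i, snd i)"
  have inj: "inj_on ?\<sigma> ?I"
    using assms by (auto intro!: inj_onI simp: group.Units_eq monoid.Units_l_cancel[OF group.is_monoid])
  have eq: "(\<lambda>(t, x). if t \<in> carrier G \<and> x \<in> topspace X then h (inv\<^bsub>G\<^esub> s \<otimes>\<^bsub>G\<^esub> t, x) else 0)
      = (\<lambda>i. if i \<in> ?I then 1 * h (?\<sigma> i) else 0)" for h :: "_ \<Rightarrow> complex"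
    by (auto simp: fun_eq_iff)
  have "\<forall>i\<in>?I. cmod 1 \<le> 1" by simp
  note b = bounded_linear_weighted_comp[of ?\<sigma> ?I "\<lambda>_. 1" 1, OF inj this]
  show ?thesis
    unfolding lambda_op_def eq bounded_linear_Blinfun_apply[OF b(1)] b(2) by simp
qed

lemma cfuns_bounded:
  assumes "compact_space X" "f \<in> cfuns X"
  obtains B where "\<And>x. x \<in> topspace X \<Longrightarrow> cmod (f x) \<le> B"
proof -
  have "compactin euclidean (f ` topspace X)"
    using assms unfolding cfuns_def compact_space_def by (blast intro: image_compactin)
  hence "bounded (f ` topspace X)"
    by (simp add: compact_imp_bounded)
  thus ?thesis using that by (auto simp: bounded_iff)
qed

lemma adj_lambda_op:
  assumes "group G" "s \<in> carrier G"
  shows "adj_op (lambda_op G X s) = lambda_op G X (inv\<^bsub>G\<^esub> s)"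
proof (rule adj_op_eqI)
  interpret group G by fact
  fix \<xi> \<eta>
  let ?I = "carrier G \<times> topspace X"
  have "cinner (lambda_op G X s \<xi>) \<eta> =
      (\<Sum>\<^sub>\<infinity>(t, x)\<in>?I. coord \<xi> (inv\<^bsub>G\<^esub> s \<otimes>\<^bsub>G\<^esub> t, x) * cnj (coord \<eta> (t, x)))"
    unfolding cinner_def by (rule infsum_cong_neutral) (auto simp: coord_lambda_op assms split: if_splits)
  also have "\<dots> = (\<Sum>\<^sub>\<infinity>(t, x)\<in>?I. coord \<xi> (t, x) * cnj (coord \<eta> (s \<otimes>\<^bsub>G\<^esub> t, x)))"
    by (rule infsum_reindex_bij_witness[of _ "\<lambda>(t, x). (s \<otimes>\<^bsub>G\<^esub> t, x)" "\<lambda>(t, x). (inv\<^bsub>G\<^esub> s \<otimes>\<^bsub>G\<^esub> t, x)"])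
      (use assms in \<open>auto simp: m_assoc[symmetric]\<close>)
  also have "\<dots> = cinner \<xi> (lambda_op G X (inv\<^bsub>G\<^esub> s) \<eta>)"
    unfolding cinner_def by (rule infsum_cong_neutral) (auto simp: coord_lambda_op assms split: if_splits)
  finally show "cinner (lambda_op G X s \<xi>) \<eta> = cinner \<xi> (lambda_op G X (inv\<^bsub>G\<^esub> s) \<eta>)" .
qed

lemma lambda_fun_covariance:
  fixes G :: "('g, 'm) monoid_scheme" and X :: "'x topology"
  assumes X: "Gamma_space G X \<phi>" and f: "f \<in> cfuns X" and s: "s \<in> carrier G"
  shows "lambda_op G X s o\<^sub>L fun_op G X \<phi> f o\<^sub>L adj_op (lambda_op G X s)
    = fun_op G X \<phi> (f \<circ> \<phi> (inv\<^bsub>G\<^esub> s))"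
proof (rule blinfun_eqI, rule ell2_eqI)
  have act: "group_action G (topspace X) \<phi>" and cpt: "compact_space X"
    using X by (auto simp: Gamma_space_def)
  interpret group_action G "topspace X" \<phi> by fact
  interpret G: group G using group_hom group_hom.axioms(1) by blast
  obtain B where B: "\<And>x. x \<in> topspace X \<Longrightarrow> cmod (f x) \<le> B"
    using cfuns_bounded[OF cpt f] by blast
  have B': "cmod ((f \<circ> \<phi> (inv\<^bsub>G\<^esub> s)) x) \<le> B" if "x \<in> topspace X" for x
    using B that s surj_prop[of "inv\<^bsub>G\<^esub> s"] by auto
  fix \<xi> and i :: "'g \<times> 'x"
  obtain t x where i: "i = (t, x)" by fastforce
  show "coord ((lambda_op G X s o\<^sub>L fun_op G X \<phi> f o\<^sub>L adj_op (lambda_op G X s)) \<xi>) i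
      = coord (fun_op G X \<phi> (f \<circ> \<phi> (inv\<^bsub>G\<^esub> s)) \<xi>) i"
  proof (cases "t \<in> carrier G \<and> x \<in> topspace X")
    case True
    hence 1: "\<phi> (inv\<^bsub>G\<^esub> s \<otimes>\<^bsub>G\<^esub> t) x = \<phi> (inv\<^bsub>G\<^esub> s) (\<phi> t x)"
      using s by (intro composition_rule) auto
    have 2: "s \<otimes>\<^bsub>G\<^esub> (inv\<^bsub>G\<^esub> s \<otimes>\<^bsub>G\<^esub> t) = t"
      using s True by (metis G.inv_closed G.l_one G.m_assoc G.r_inv)
    show ?thesis
      using s True by (simp add: i adj_lambda_op[OF G.is_group] coord_lambda_op[OF G.is_group]
          coord_fun_op[OF act B] coord_fun_op[OF act B'] 1 2)
  next
    case False
    thus ?thesis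
      using s by (auto simp: i coord_lambda_op[OF G.is_group] coord_fun_op[OF act B'])
  qed
qed

text \<open>These properties determine the conditional expectation on the crossed product.\<close>

lemma cond_exp_generator:
  assumes X: "Gamma_space G X \<phi>" and f: "f \<in> cfuns X" and s: "s \<in> carrier G"
    and x: "x \<in> topspace X"
  shows "cond_exp G (fun_op G X \<phi> f o\<^sub>L lambda_op G X s) x = (if s = \<one>\<^bsub>G\<^esub> then f x else 0)"
proof -
  have act: "group_action G (topspace X) \<phi>" and cpt: "compact_space X"
    using X by (auto simp: Gamma_space_def)
  interpret group_action G "topspace X" \<phi> by fact
  interpret G: group G using group_hom group_hom.axioms(1) by blast
  obtain B where B: "\<And>x. x \<in> topspace X \<Longrightarrow> cmod (f x) \<le> B"
    using cfuns_bounded[OF cpt f] by blast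
  have one: "\<phi> \<one>\<^bsub>G\<^esub> x = x"
    unfolding id_eq_one[symmetric] using x by simp
  have "inv\<^bsub>G\<^esub> s = \<one>\<^bsub>G\<^esub> \<longleftrightarrow> s = \<one>\<^bsub>G\<^esub>"
    using s G.inv_eq_1_iff by blast
  thus ?thesis
    using s x by (simp add: cond_exp_def coord_fun_op[OF act B] coord_lambda_op[OF G.is_group] coord_ket one)
qed

lemma cond_exp_add: "cond_exp G (a + b) x = cond_exp G a x + cond_exp G b x"
  by (simp add: cond_exp_def blinfun.add_left coord_add)

lemma cond_exp_cscale: "cond_exp G (cscale_op c a) x = c * cond_exp G a x"
  by (simp add: cond_exp_def cscale_op_apply coord_cscale)

lemma cmod_cond_exp_le: "cmod (cond_exp G a x) \<le> norm a"
  unfolding cond_exp_def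
  using cmod_coord_le[of "a (ket (\<one>\<^bsub>G\<^esub>, x))" "(\<one>\<^bsub>G\<^esub>, x)"] norm_blinfun[of a "ket (\<one>\<^bsub>G\<^esub>, x)"]
  by (simp add: norm_ket)

end

(*
  Write Phi(a) = sum_j g_j lambda(s_j) a lambda(s_j)^* g_j.  In the regular representation the
  matrix of Phi(f lambda(t)), f in C(X), is dominated entrywise by that of the average of
  |f|_oo lambda(t) computed over Y, because the weights g_j are nonnegative.  Hence plumpness
  over Y makes Phi small on the off-diagonal part of any element of the crossed product over X.
  A nonzero ideal I of A contains some a = c^* c with E(a) >= 0 nonzero; by minimality and
  compactness, summing finitely many H-translates yields b in I with E(b) >= eta > 0.  With
  M = |b|, contractivity of Phi and Phi(1) = 1 give |M - Phi(b)| < M, so 1 - Phi(b)/M has norm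
  less than 1, and its powers, which are congruent to 1 modulo I, tend to 0; thus 1 lies in I.
*)
theory Submission
  imports Defs
begin

section \<open>Square-summable families\<close>

text \<open>The ideal lives over X while plumpness speaks only about operators over Y, and
  coefficients in C(X) have no canonical image in C(Y). Only sizes are transferred: constants
  bounding the coefficients turn a finite sum without a term at the identity into an element over Y
  whose expectation is 0. The norm comparison is made on one fibre over a point of X at a time,
  against the fibre over its image, so points with the same image do not interfere.

  The diagonal part is not averaged to its expectation: conjugation by \<lambda>(s) moves a
  function, and E(b) need not be close to a constant. The bounds \<eta> \<le> E(b) \<le> M suffice,
  since M - E(b) then has norm at most M - \<eta> before averaging; the gap \<eta> absorbs the
  approximation errors.

  The expectation is handled as a pointwise function. Where continuity is required, the coefficient
  at the identity of a nearby finite sum stands in for it.\<close>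

lemma coord_sum: "coord (\<Sum>j\<in>J. u j) i = (\<Sum>j\<in>J. coord (u j) i)"
  by (induction J rule: infinite_finite_induct) (auto simp: coord_zero coord_add)

lemma bounded_linear_coord: "bounded_linear (\<lambda>\<xi>. coord \<xi> i)"
  by (rule bounded_linear_intro[where K = 1])
    (auto simp: coord_add coord_scaleR cmod_coord_le scaleR_conv_of_real)

lemma coord_eq_cinner_ket: "coord \<xi> i = cinner \<xi> (ket i)"
proof -
  have "cinner \<xi> (ket i) = (\<Sum>\<^sub>\<infinity>j\<in>{i}. coord \<xi> j)"
    unfolding cinner_def by (rule infsum_cong_neutral) (auto simp: coord_ket)
  thus ?thesis by simp
qed

lemma has_sum_sum:
  fixes f :: "'j \<Rightarrow> 'i \<Rightarrow> 'a :: topological_comm_monoid_add"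
  assumes "\<And>j. j \<in> J \<Longrightarrow> (f j has_sum l j) A"
  shows "((\<lambda>i. \<Sum>j\<in>J. f j i) has_sum (\<Sum>j\<in>J. l j)) A"
  using assms by (induction J rule: infinite_finite_induct) (auto intro: has_sum_add)

lemma has_sum_norm_square: "((\<lambda>i. (cmod (coord \<xi> i))\<^sup>2) has_sum (norm \<xi>)\<^sup>2) UNIV"
  unfolding norm_ell2_square by (rule has_sum_infsum[OF coord_summable])

text \<open>With a singleton index set on one side, this turns a coordinatewise bound into a norm
  bound for a row or a column of operators.\<close>

lemma sum_norm_squares_mono:
  fixes u :: "'j \<Rightarrow> 'i ell2" and v :: "'k \<Rightarrow> 'i ell2"
  assumes "\<And>i. (\<Sum>j\<in>J. (cmod (coord (u j) i))\<^sup>2) \<le> (\<Sum>k\<in>K. (cmod (coord (v k) i))\<^sup>2)"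
  shows "(\<Sum>j\<in>J. (norm (u j))\<^sup>2) \<le> (\<Sum>k\<in>K. (norm (v k))\<^sup>2)"
  by (rule has_sum_mono[OF has_sum_sum has_sum_sum assms]) (rule has_sum_norm_square)+

lemma norm_ell2_mono:
  assumes "\<And>i. cmod (coord \<xi> i) \<le> cmod (coord \<eta> i)"
  shows "norm \<xi> \<le> norm \<eta>"
proof -
  have "(norm \<xi>)\<^sup>2 \<le> (norm \<eta>)\<^sup>2"
    using sum_norm_squares_mono[where J = "{()}" and u = "\<lambda>_. \<xi>" and K = "{()}" and v = "\<lambda>_. \<eta>"] assms
    by (simp add: power_mono)
  thus ?thesis by (rule power2_le_imp_le) simp
qed

lemma cinner_self_norm: "cinner \<xi> \<xi> = complex_of_real ((norm \<xi>)\<^sup>2)"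
  by (simp add: cinner_self norm_ell2_square)

lemma cinner_cscale_right: "cinner \<xi> (cscale c \<eta>) = cnj c * cinner \<xi> \<eta>"
  by (subst (1 2) cinner_commute) (simp add: cinner_cscale_left)

lemma cinner_add_right: "cinner \<xi> (\<eta> + \<eta>') = cinner \<xi> \<eta> + cinner \<xi> \<eta>'"
  by (subst (1 2 3) cinner_commute) (simp add: cinner_add_left)

lemma cinner_sum_right: "cinner \<xi> (\<Sum>j\<in>J. u j) = (\<Sum>j\<in>J. cinner \<xi> (u j))"
proof (induction J rule: infinite_finite_induct)
  case empty
  have "cinner \<xi> 0 = 0" by (simp add: cinner_def coord_zero)
  thus ?case by simp
next
  case (infinite J)
  have "cinner \<xi> 0 = 0" by (simp add: cinner_def coord_zero)
  thus ?case using infinite by simp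
qed (simp add: cinner_add_right)

text \<open>Reduces boundedness of \<open>cinner\<close> in its first argument to that of the real
  inner product.\<close>

lemma cinner_eq_inner:
  "cinner \<xi> \<eta> = complex_of_real (\<xi> \<bullet> \<eta>) + \<i> * complex_of_real (\<xi> \<bullet> cscale \<i> \<eta>)"
  by (simp add: inner_ell2_def cinner_cscale_right complex_eq_iff)

lemma bounded_linear_cinner_left: "bounded_linear (\<lambda>\<xi>. cinner \<xi> \<eta>)"
  unfolding cinner_eq_inner
  by (intro bounded_linear_add bounded_linear_const_mult bounded_linear_compose[OF bounded_linear_of_real]
      bounded_linear_inner_left)

text \<open>The remainder after a finite set F agrees with \<open>\<xi>\<close> up to sign outside F
  and vanishes on F, so its squared norm is the tail of a convergent series. Through this expansion
  a complex-linear operator is determined by its values on kets.\<close>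

lemma has_sum_ket_expansion: "((\<lambda>i. cscale (coord \<xi> i) (ket i)) has_sum \<xi>) UNIV"
proof -
  let ?q = "\<lambda>i. (cmod (coord \<xi> i))\<^sup>2"
  let ?P = "\<lambda>F. \<Sum>i\<in>F. cscale (coord \<xi> i) (ket i)"
  have c: "coord (?P F - \<xi>) j = (if j \<in> F then 0 else - coord \<xi> j)" if "finite F" for F j
    using that by (simp add: coord_minus coord_sum coord_cscale coord_ket if_distrib cong: if_cong)
  have n: "(norm (?P F - \<xi>))\<^sup>2 = infsum ?q UNIV - sum ?q F" if "finite F" for F
  proof -
    have "(norm (?P F - \<xi>))\<^sup>2 = infsum ?q (UNIV - F)"
      unfolding norm_ell2_square c[OF that] by (rule infsum_cong_neutral) auto
    thus ?thesis using that by (simp add: infsum_Diff coord_summable)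
  qed
  have "((\<lambda>F. sum ?q F) \<longlongrightarrow> infsum ?q UNIV) (finite_subsets_at_top UNIV)"
    using has_sum_infsum[OF coord_summable[of \<xi>]] by (simp add: has_sum_def)
  hence "((\<lambda>F. sqrt (infsum ?q UNIV - sum ?q F)) \<longlongrightarrow> sqrt (infsum ?q UNIV - infsum ?q UNIV))
      (finite_subsets_at_top UNIV)"
    by (intro tendsto_intros)
  moreover have "\<forall>\<^sub>F F in finite_subsets_at_top UNIV.
      sqrt (infsum ?q UNIV - sum ?q F) = norm (?P F - \<xi>)"
    using eventually_finite_subsets_at_top_weakI[of UNIV "\<lambda>F. sqrt (infsum ?q UNIV - sum ?q F) = norm (?P F - \<xi>)"]
    by (simp add: n[symmetric])
  ultimately have "((\<lambda>F. norm (?P F - \<xi>)) \<longlongrightarrow> 0) (finite_subsets_at_top UNIV)"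
    by (simp add: tendsto_cong)
  thus ?thesis
    unfolding has_sum_def by (simp add: tendsto_norm_zero_iff LIM_zero_iff)
qed

section \<open>Adjoints of complex-linear operators\<close>

text \<open>The adjoint is built from its matrix coefficients, which avoids proving completeness of
  the space of square-summable families.\<close>

lemma cinner_adj_op:
  fixes T :: "'i operator"
  assumes lin: "\<And>c \<xi>. T (cscale c \<xi>) = cscale c (T \<xi>)"
  shows "cinner (T \<xi>) \<eta> = cinner \<xi> (adj_op T \<eta>)"
proof -
  \<comment> \<open>Pairing with \<open>ket i\<close> forces this value for coordinate
    \<open>i\<close> of the adjoint applied to \<open>\<eta>\<close>.\<close>
  define f where "f = (\<lambda>\<eta> i. cinner \<eta> (T (ket i)))"
  have fin: "(\<Sum>i\<in>F. (cmod (f \<eta> i))\<^sup>2) \<le> (norm \<eta> * norm T)\<^sup>2" if F: "finite F" for F \<eta>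
  proof -
    \<comment> \<open>The truncated candidate for the adjoint vector serves as its own test vector:
      \<open>cinner \<eta> (T \<zeta>)\<close> equals the partial sum \<open>R\<close>, which is
      also the squared norm of \<open>\<zeta>\<close>, so one factor \<open>norm \<zeta>\<close>
      cancels.\<close>
    define \<zeta> where "\<zeta> = (\<Sum>i\<in>F. cscale (f \<eta> i) (ket i))"
    define R where "R = (\<Sum>i\<in>F. (cmod (f \<eta> i))\<^sup>2)"
    have c: "coord \<zeta> j = (if j \<in> F then f \<eta> j else 0)" for j
      using F by (simp add: \<zeta>_def coord_sum coord_cscale coord_ket if_distrib cong: if_cong)
    have nz: "(norm \<zeta>)\<^sup>2 = R"
    proof -
      have "(norm \<zeta>)\<^sup>2 = (\<Sum>\<^sub>\<infinity>i\<in>F. (cmod (f \<eta> i))\<^sup>2)"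
        unfolding norm_ell2_square c by (rule infsum_cong_neutral) auto
      thus ?thesis using F by (simp add: R_def)
    qed
    have "cinner \<eta> (T \<zeta>) = (\<Sum>i\<in>F. cnj (f \<eta> i) * f \<eta> i)"
      by (simp add: \<zeta>_def blinfun.sum_right lin cinner_sum_right cinner_cscale_right f_def)
    also have "\<dots> = complex_of_real R"
      unfolding R_def of_real_sum
      by (intro sum.cong refl) (simp only: complex_norm_square mult.commute)
    finally have "R = \<eta> \<bullet> T \<zeta>" by (simp add: inner_ell2_def)
    also have "\<dots> \<le> norm \<eta> * norm (T \<zeta>)" by (rule norm_cauchy_schwarz)
    also have "\<dots> \<le> norm \<eta> * (norm T * norm \<zeta>)"
      by (intro mult_left_mono norm_blinfun) simp
    finally have "norm \<zeta> * norm \<zeta> \<le> (norm \<eta> * norm T) * norm \<zeta>"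
      by (simp add: nz[symmetric] power2_eq_square mult_ac)
    hence "norm \<zeta> \<le> norm \<eta> * norm T"
      by (cases "norm \<zeta> = 0") auto
    hence "(norm \<zeta>)\<^sup>2 \<le> (norm \<eta> * norm T)\<^sup>2" by (rule power_mono) simp
    thus ?thesis by (simp add: nz R_def)
  qed
  have smm: "(\<lambda>i. (cmod (f \<eta> i))\<^sup>2) summable_on UNIV" for \<eta>
    by (rule nonneg_bdd_above_summable_on) (auto intro!: bdd_aboveI2 fin)
  define S where "S = (\<lambda>\<eta>. ell2_of (f \<eta>))"
  have cS: "coord (S \<eta>) i = f \<eta> i" for \<eta> i
    by (simp add: S_def coord_ell2_of smm)
  have "bounded_linear S"
  proof (rule bounded_linear_intro)
    show "S (x + y) = S x + S y" for x y
      by (rule ell2_eqI) (simp add: cS coord_add f_def cinner_add_left)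
    show "S (r *\<^sub>R x) = r *\<^sub>R S x" for r x
      by (rule ell2_eqI) (simp add: cS coord_scaleR f_def scaleR_eq_cscale coord_cscale cinner_cscale_left)
    show "norm (S \<eta>) \<le> norm \<eta> * norm T" for \<eta>
    proof (rule power2_le_imp_le)
      show "(norm (S \<eta>))\<^sup>2 \<le> (norm \<eta> * norm T)\<^sup>2"
        unfolding norm_ell2_square cS by (rule infsum_le_finite_sums[OF smm fin])
    qed simp
  qed
  hence B: "blinfun_apply (Blinfun S) = S" by (rule bounded_linear_Blinfun_apply)
  have id: "cinner (T \<xi>) \<eta> = cinner \<xi> (Blinfun S \<eta>)" for \<xi> \<eta>
  proof -
    have "((\<lambda>i. cinner (T (cscale (coord \<xi> i) (ket i))) \<eta>) has_sum cinner (T \<xi>) \<eta>) UNIV"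
      using has_sum_bounded_linear[OF bounded_linear_compose[OF bounded_linear_cinner_left[of \<eta>]
            blinfun.bounded_linear_right[of T]] has_sum_ket_expansion[of \<xi>]]
      by (simp add: o_def)
    hence "cinner (T \<xi>) \<eta> = (\<Sum>\<^sub>\<infinity>i. cinner (T (cscale (coord \<xi> i) (ket i))) \<eta>)"
      by (rule infsumI[symmetric])
    also have "\<dots> = cinner \<xi> (S \<eta>)"
      unfolding cinner_def[of \<xi> "S \<eta>"] cS f_def
      by (simp add: lin cinner_cscale_left cinner_commute[of "T _" \<eta>])
    finally show ?thesis by (simp add: B)
  qed
  show ?thesis by (simp add: adj_op_eqI[OF id] id)
qed

text \<open>Source of both positivity and faithfulness of the expectation: a diagonal entry of
  \<open>T^* T\<close> vanishes only if \<open>T\<close> kills the corresponding ket.\<close>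

lemma coord_adj_op_self:
  fixes T :: "'i operator"
  assumes "\<And>c \<xi>. T (cscale c \<xi>) = cscale c (T \<xi>)"
  shows "coord (adj_op T (T (ket i))) i = complex_of_real ((norm (T (ket i)))\<^sup>2)"
proof -
  have "coord (adj_op T (T (ket i))) i = cnj (cinner (ket i) (adj_op T (T (ket i))))"
    by (simp add: coord_eq_cinner_ket cinner_commute[symmetric])
  also have "\<dots> = complex_of_real ((norm (T (ket i)))\<^sup>2)"
    by (simp add: cinner_adj_op[OF assms, symmetric] cinner_self_norm del: of_real_power)
  finally show ?thesis .
qed

section \<open>Norm domination on fibres\<close>

text \<open>Moves the modulus of \<open>\<xi>\<close> on the fibre over \<open>x\<close> to the
  fibre over \<open>y\<close>. Phases are discarded so that a matrix with nonnegative entries,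
  applied to the result, bounds every dominated matrix applied to \<open>\<xi>\<close>.\<close>

definition fibre_vec :: "'y \<Rightarrow> 'x \<Rightarrow> ('g \<times> 'x) ell2 \<Rightarrow> ('g \<times> 'y) ell2" where
  "fibre_vec y x \<xi> = ell2_of (\<lambda>(t, y'). if y' = y then complex_of_real (cmod (coord \<xi> (t, x))) else 0)"

lemma summable_fibre: "(\<lambda>t. (cmod (coord \<xi> (t, x)))\<^sup>2) summable_on UNIV"
proof -
  have "(\<lambda>i. (cmod (coord \<xi> i))\<^sup>2) summable_on range (\<lambda>t. (t, x))"
    by (rule summable_on_subset_banach[OF coord_summable]) simp
  thus ?thesis by (subst (asm) summable_on_reindex) (auto simp: inj_on_def o_def)
qed

lemma infsum_fibre_supported:
  fixes h :: "'g \<times> 'y \<Rightarrow> real"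
  assumes "\<And>t y'. y' \<noteq> y \<Longrightarrow> h (t, y') = 0"
  shows "infsum h UNIV = (\<Sum>\<^sub>\<infinity>t. h (t, y))"
    and "h summable_on UNIV \<longleftrightarrow> (\<lambda>t. h (t, y)) summable_on UNIV"
proof -
  have "infsum h UNIV = infsum h (range (\<lambda>t. (t, y)))"
    by (rule infsum_cong_neutral) (use assms in auto)
  thus "infsum h UNIV = (\<Sum>\<^sub>\<infinity>t. h (t, y))"
    by (subst (asm) infsum_reindex) (auto simp: inj_on_def o_def)
  have "h summable_on UNIV \<longleftrightarrow> h summable_on (range (\<lambda>t. (t, y)))"
    by (rule summable_on_cong_neutral) (use assms in auto)
  thus "h summable_on UNIV \<longleftrightarrow> (\<lambda>t. h (t, y)) summable_on UNIV"
    by (subst (asm) summable_on_reindex) (auto simp: inj_on_def o_def)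
qed

lemma coord_fibre_vec:
  "coord (fibre_vec y x \<xi>) (t, y') = (if y' = y then complex_of_real (cmod (coord \<xi> (t, x))) else 0)"
proof -
  let ?f = "\<lambda>(t, y'). if y' = y then complex_of_real (cmod (coord \<xi> (t, x))) else 0"
  have "(\<lambda>i. (cmod (?f i))\<^sup>2) summable_on UNIV"
    by (subst infsum_fibre_supported(2)[where y = y]) (auto simp: summable_fibre)
  thus ?thesis by (simp add: fibre_vec_def coord_ell2_of)
qed

lemma norm_fibre_vec: "(norm (fibre_vec y x \<xi>))\<^sup>2 = (\<Sum>\<^sub>\<infinity>t. (cmod (coord \<xi> (t, x)))\<^sup>2)"
  unfolding norm_ell2_square
  by (subst infsum_fibre_supported(1)[where y = y]) (auto simp: coord_fibre_vec)

lemma norm_ell2_square_fibres: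
  fixes \<xi> :: "('g \<times> 'x) ell2"
  shows "(\<lambda>x. \<Sum>\<^sub>\<infinity>t. (cmod (coord \<xi> (t, x)))\<^sup>2) summable_on UNIV"
    and "(norm \<xi>)\<^sup>2 = (\<Sum>\<^sub>\<infinity>x. \<Sum>\<^sub>\<infinity>t. (cmod (coord \<xi> (t, x)))\<^sup>2)"
proof -
  let ?q = "\<lambda>(x, t). (cmod (coord \<xi> (t, x)))\<^sup>2"
  have "?q summable_on prod.swap ` UNIV"
    by (subst summable_on_reindex) (auto simp: o_def case_prod_unfold coord_summable)
  hence s: "?q summable_on (SIGMA x:UNIV. UNIV)" by simp
  show "(\<lambda>x. \<Sum>\<^sub>\<infinity>t. (cmod (coord \<xi> (t, x)))\<^sup>2) summable_on UNIV"
    using summable_on_Sigma_banach[OF s] by simp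
  have "(norm \<xi>)\<^sup>2 = infsum ?q (prod.swap ` UNIV)"
    by (subst infsum_reindex) (auto simp: o_def case_prod_unfold norm_ell2_square)
  also have "\<dots> = infsum ?q (SIGMA x:UNIV. UNIV)" by simp
  also have "\<dots> = (\<Sum>\<^sub>\<infinity>x. \<Sum>\<^sub>\<infinity>t. (cmod (coord \<xi> (t, x)))\<^sup>2)"
    using infsum_Sigma'_banach[OF s] by simp
  finally show "(norm \<xi>)\<^sup>2 = (\<Sum>\<^sub>\<infinity>x. \<Sum>\<^sub>\<infinity>t. (cmod (coord \<xi> (t, x)))\<^sup>2)" .
qed

text \<open>The squared norm is the sum over \<open>x\<close> of squared norms along fibres, and
  each fibre is estimated by its own vector \<open>fibre_vec (p x) x \<xi>\<close>. Points with the
  same image under \<open>p\<close> therefore use separate copies of the same estimate, and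
  \<open>p\<close> may be far from injective.\<close>

lemma norm_le_of_fibrewise_domination:
  fixes T :: "('g \<times> 'x) operator" and S :: "('g \<times> 'y) operator"
  assumes dom: "\<And>\<xi> r x. cmod (coord (T \<xi>) (r, x)) \<le> cmod (coord (S (fibre_vec (p x) x \<xi>)) (r, p x))"
  shows "norm T \<le> norm S"
proof (rule norm_blinfun_bound)
  fix \<xi>
  have fib: "(\<Sum>\<^sub>\<infinity>r. (cmod (coord (T \<xi>) (r, x)))\<^sup>2) \<le> (norm S)\<^sup>2 * (\<Sum>\<^sub>\<infinity>t. (cmod (coord \<xi> (t, x)))\<^sup>2)" for x
  proof -
    let ?\<zeta> = "S (fibre_vec (p x) x \<xi>)"
    have "(\<Sum>\<^sub>\<infinity>r. (cmod (coord (T \<xi>) (r, x)))\<^sup>2) \<le> (\<Sum>\<^sub>\<infinity>r. (cmod (coord ?\<zeta> (r, p x)))\<^sup>2)"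
      by (intro infsum_mono summable_fibre power_mono dom) auto
    also have "\<dots> = (norm (fibre_vec (p x) (p x) ?\<zeta>))\<^sup>2"
      by (simp add: norm_fibre_vec)
    also have "\<dots> \<le> (norm ?\<zeta>)\<^sup>2"
      by (intro power_mono norm_ell2_mono) (auto simp: coord_fibre_vec split: prod.splits)
    also have "\<dots> \<le> (norm S * norm (fibre_vec (p x) x \<xi>))\<^sup>2"
      by (intro power_mono norm_blinfun) auto
    finally show ?thesis by (simp add: power_mult_distrib norm_fibre_vec)
  qed
  have "(norm (T \<xi>))\<^sup>2 \<le> (\<Sum>\<^sub>\<infinity>x. (norm S)\<^sup>2 * (\<Sum>\<^sub>\<infinity>t. (cmod (coord \<xi> (t, x)))\<^sup>2))"
    unfolding norm_ell2_square_fibres(2)[of "T \<xi>"]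
    by (intro infsum_mono norm_ell2_square_fibres(1) summable_on_cmult_right fib)
  also have "\<dots> = (norm S * norm \<xi>)\<^sup>2"
    by (simp add: infsum_cmult_right' power_mult_distrib norm_ell2_square_fibres(2))
  finally show "norm (T \<xi>) \<le> norm S * norm \<xi>" by (rule power2_le_imp_le) simp
qed simp

section \<open>Operators of a dynamical system\<close>

locale topological_dynamics =
  fixes G :: "('g, 'm) monoid_scheme" (structure) and X :: "'x topology" and \<phi> :: "'g \<Rightarrow> 'x \<Rightarrow> 'x"
  assumes Gamma_space: "Gamma_space G X \<phi>"
begin

sublocale group_action G "topspace X" \<phi>
  using Gamma_space by (simp add: Gamma_space_def)

sublocale group G
  using group_hom group_hom.axioms(1) by blast

abbreviation "fop \<equiv> fun_op G X \<phi>"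
abbreviation "lop \<equiv> lambda_op G X"

lemma action_closed: "t \<in> carrier G \<Longrightarrow> x \<in> topspace X \<Longrightarrow> \<phi> t x \<in> topspace X"
  using surj_prop by blast

lemma action_one: "x \<in> topspace X \<Longrightarrow> \<phi> \<one> x = x"
  unfolding id_eq_one[symmetric] by simp

lemma coord_fop:
  assumes "f \<in> cfuns X"
  shows "coord (fop f \<xi>) (t, x) =
    (if t \<in> carrier G \<and> x \<in> topspace X then f (\<phi> t x) * coord \<xi> (t, x) else 0)"
proof -
  have "compact_space X" using Gamma_space by (simp add: Gamma_space_def)
  then obtain B where "\<And>x. x \<in> topspace X \<Longrightarrow> cmod (f x) \<le> B"
    using cfuns_bounded assms by blast
  thus ?thesis by (rule coord_fun_op[OF group_action_axioms])
qed

lemmas coord_lop = coord_lambda_op[OF is_group]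
lemmas adj_lop = adj_lambda_op[OF is_group]

lemma const_in_cfuns [simp]: "(\<lambda>_. c) \<in> cfuns X"
  by (simp add: cfuns_def)

lemma norm_fop_le:
  assumes f: "f \<in> cfuns X" and B: "\<And>x. x \<in> topspace X \<Longrightarrow> cmod (f x) \<le> B" and "0 \<le> B"
  shows "norm (fop f) \<le> B"
proof (rule norm_blinfun_bound)
  fix \<xi>
  have "norm (fop f \<xi>) \<le> norm (B *\<^sub>R \<xi>)"
  proof (rule norm_ell2_mono)
    fix i :: "'g \<times> 'x"
    obtain t x where i: "i = (t, x)" by fastforce
    show "cmod (coord (fop f \<xi>) i) \<le> cmod (coord (B *\<^sub>R \<xi>) i)"
      using \<open>0 \<le> B\<close>
      by (auto simp: i coord_fop[OF f] coord_scaleR norm_mult action_closed intro!: mult_right_mono B)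
  qed
  thus "norm (fop f \<xi>) \<le> B * norm \<xi>" using \<open>0 \<le> B\<close> by simp
qed fact

text \<open>An inequality rather than an equality: \<open>lop s\<close> permutes the kets indexed by
  \<open>carrier G \<times> topspace X\<close> and annihilates the remaining ones.\<close>

lemma norm_lop_le:
  assumes s: "s \<in> carrier G"
  shows "norm (lop s) \<le> 1"
proof (rule norm_blinfun_bound)
  fix \<xi>
  let ?I = "carrier G \<times> topspace X"
  have "(norm (lop s \<xi>))\<^sup>2 = (\<Sum>\<^sub>\<infinity>(t, x)\<in>?I. (cmod (coord \<xi> (inv s \<otimes> t, x)))\<^sup>2)"
    unfolding norm_ell2_square
    by (rule infsum_cong_neutral) (auto simp: coord_lop s split: if_splits)
  also have "\<dots> = (\<Sum>\<^sub>\<infinity>(t, x)\<in>?I. (cmod (coord \<xi> (t, x)))\<^sup>2)"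
    by (rule infsum_reindex_bij_witness[of _ "\<lambda>(t, x). (s \<otimes> t, x)" "\<lambda>(t, x). (inv s \<otimes> t, x)"])
      (use s in \<open>auto simp: m_assoc[symmetric]\<close>)
  also have "\<dots> \<le> (norm \<xi>)\<^sup>2"
    unfolding norm_ell2_square
    by (rule infsum_mono_neutral)
      (auto simp: coord_summable case_prod_unfold intro: summable_on_subset_banach[OF coord_summable])
  finally have "norm (lop s \<xi>) \<le> norm \<xi>" by (rule power2_le_imp_le) simp
  thus "norm (lop s \<xi>) \<le> 1 * norm \<xi>" by simp
qed simp

lemma coord_crossed_sum:
  assumes "K \<subseteq> carrier G" "\<And>t. t \<in> K \<Longrightarrow> f t \<in> cfuns X"
  shows "coord ((\<Sum>t\<in>K. fop (f t) o\<^sub>L lop t) \<xi>) (r, x) =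
    (if r \<in> carrier G \<and> x \<in> topspace X
     then \<Sum>t\<in>K. f t (\<phi> r x) * coord \<xi> (inv t \<otimes> r, x) else 0)"
  using assms
  by (auto simp: blinfun.sum_left coord_sum coord_fop coord_lop subset_eq intro!: sum.cong)

lemma cond_exp_crossed_sum:
  assumes K: "K \<subseteq> carrier G" "finite K" and f: "\<And>t. t \<in> K \<Longrightarrow> f t \<in> cfuns X"
    and x: "x \<in> topspace X"
  shows "cond_exp G (\<Sum>t\<in>K. fop (f t) o\<^sub>L lop t) x = (if \<one> \<in> K then f \<one> x else 0)"
proof -
  have "cond_exp G (\<Sum>t\<in>K. fop (f t) o\<^sub>L lop t) x = (\<Sum>t\<in>K. if t = \<one> then f t x else 0)"
  proof -
    have "(\<Sum>t\<in>K. f t (\<phi> \<one> x) * coord (ket (\<one>, x)) (inv t \<otimes> \<one>, x)) = (\<Sum>t\<in>K. if t = \<one> then f t x else 0)"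
      by (rule sum.cong) (use K x in \<open>auto simp: action_one coord_ket subset_eq inv_eq_1_iff\<close>)
    thus ?thesis
      unfolding cond_exp_def using K f x by (subst coord_crossed_sum) auto
  qed
  thus ?thesis using K by simp
qed

end

section \<open>Weighted averages of conjugates\<close>

definition average :: "('g, 'm) monoid_scheme \<Rightarrow> 'x topology \<Rightarrow> ('g \<Rightarrow> 'x \<Rightarrow> 'x) \<Rightarrow>
    nat \<Rightarrow> (nat \<Rightarrow> 'g) \<Rightarrow> (nat \<Rightarrow> 'x \<Rightarrow> complex) \<Rightarrow> ('g \<times> 'x) operator \<Rightarrow> ('g \<times> 'x) operator" where
  "average G X \<phi> m s g a = (\<Sum>j<m. fun_op G X \<phi> (g j) o\<^sub>L lambda_op G X (s j) o\<^sub>L a o\<^sub>L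
      adj_op (lambda_op G X (s j)) o\<^sub>L fun_op G X \<phi> (g j))"

lemma average_diff: "average G X \<phi> m s g (a - b) = average G X \<phi> m s g a - average G X \<phi> m s g b"
  by (rule blinfun_eqI)
    (simp add: average_def blinfun.sum_left blinfun.bilinear_simps sum_subtractf)

context topological_dynamics
begin

text \<open>The average factors as a row of multiplications, \<open>m\<close> copies of conjugates
  of \<open>a\<close>, and a column of multiplications. The hypothesis \<open>sq\<close> makes both
  outer factors contractions; for the row this is the Cauchy-Schwarz inequality at each
  coordinate.\<close>

lemma norm_average_le:
  assumes s: "\<And>j. j < m \<Longrightarrow> s j \<in> carrier G" and g: "\<And>j. j < m \<Longrightarrow> g j \<in> cfuns X"
    and sq: "\<And>x. x \<in> topspace X \<Longrightarrow> (\<Sum>j<m. (cmod (g j x))\<^sup>2) \<le> 1"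
  shows "norm (average G X \<phi> m s g a) \<le> norm a"
proof (rule norm_blinfun_bound)
  fix \<xi>
  define u where "u = (\<lambda>j. lop (s j) (a (adj_op (lop (s j)) (fop (g j) \<xi>))))"
  have "(\<Sum>j\<in>{()}. (norm (average G X \<phi> m s g a \<xi>))\<^sup>2) \<le> (\<Sum>j<m. (norm (u j))\<^sup>2)"
  proof (rule sum_norm_squares_mono)
    fix i :: "'g \<times> 'x"
    obtain t x where i: "i = (t, x)" by fastforce
    have c: "coord (average G X \<phi> m s g a \<xi>) i =
        (if t \<in> carrier G \<and> x \<in> topspace X then \<Sum>j<m. g j (\<phi> t x) * coord (u j) i else 0)"
      by (cases "t \<in> carrier G \<and> x \<in> topspace X")
        (auto simp: average_def blinfun.sum_left coord_sum coord_fop g i u_def)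
    show "(\<Sum>j\<in>{()}. (cmod (coord (average G X \<phi> m s g a \<xi>) i))\<^sup>2) \<le> (\<Sum>j<m. (cmod (coord (u j) i))\<^sup>2)"
    proof (cases "t \<in> carrier G \<and> x \<in> topspace X")
      case True
      have "(cmod (coord (average G X \<phi> m s g a \<xi>) i))\<^sup>2
          \<le> (\<Sum>j<m. cmod (g j (\<phi> t x)) * cmod (coord (u j) i))\<^sup>2"
        using True
        by (auto simp: c norm_mult[symmetric] intro!: power_mono norm_sum)
      also have "\<dots> \<le> (\<Sum>j<m. (cmod (g j (\<phi> t x)))\<^sup>2) * (\<Sum>j<m. (cmod (coord (u j) i))\<^sup>2)"
        by (rule Cauchy_Schwarz_ineq_sum)
      also have "\<dots> \<le> 1 * (\<Sum>j<m. (cmod (coord (u j) i))\<^sup>2)"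
        using True by (intro mult_right_mono sq sum_nonneg) (auto intro: action_closed)
      finally show ?thesis by simp
    qed (auto simp: c sum_nonneg)
  qed
  also have "\<dots> \<le> (\<Sum>j<m. (norm a)\<^sup>2 * (norm (fop (g j) \<xi>))\<^sup>2)"
  proof (rule sum_mono)
    fix j assume "j \<in> {..<m}"
    hence sj: "s j \<in> carrier G" using s by simp
    have contr: "norm (lop t \<eta>) \<le> norm \<eta>" if "t \<in> carrier G" for t \<eta>
      using norm_blinfun[of "lop t" \<eta>] mult_right_mono[OF norm_lop_le[OF that], of "norm \<eta>"] by simp
    have "norm (u j) \<le> norm (a (adj_op (lop (s j)) (fop (g j) \<xi>)))"
      unfolding u_def by (rule contr[OF sj])
    also have "\<dots> \<le> norm a * norm (adj_op (lop (s j)) (fop (g j) \<xi>))"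
      by (rule norm_blinfun)
    also have "\<dots> \<le> norm a * norm (fop (g j) \<xi>)"
      using sj by (intro mult_left_mono) (auto simp: adj_lop intro!: contr)
    finally have "(norm (u j))\<^sup>2 \<le> (norm a * norm (fop (g j) \<xi>))\<^sup>2" by (rule power_mono) simp
    thus "(norm (u j))\<^sup>2 \<le> (norm a)\<^sup>2 * (norm (fop (g j) \<xi>))\<^sup>2"
      by (simp add: power_mult_distrib)
  qed
  also have "\<dots> = (norm a)\<^sup>2 * (\<Sum>j<m. (norm (fop (g j) \<xi>))\<^sup>2)"
    by (simp add: sum_distrib_left)
  also have "(\<Sum>j<m. (norm (fop (g j) \<xi>))\<^sup>2) \<le> (\<Sum>j\<in>{()}. (norm \<xi>)\<^sup>2)"
  proof (rule sum_norm_squares_mono)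
    fix i :: "'g \<times> 'x"
    obtain t x where i: "i = (t, x)" by fastforce
    show "(\<Sum>j<m. (cmod (coord (fop (g j) \<xi>) i))\<^sup>2) \<le> (\<Sum>j\<in>{()}. (cmod (coord \<xi> i))\<^sup>2)"
    proof (cases "t \<in> carrier G \<and> x \<in> topspace X")
      case True
      have "(\<Sum>j<m. (cmod (coord (fop (g j) \<xi>) i))\<^sup>2)
          = (\<Sum>j<m. (cmod (g j (\<phi> t x)))\<^sup>2) * (cmod (coord \<xi> i))\<^sup>2"
        using True
        by (simp add: i coord_fop g norm_mult power_mult_distrib sum_distrib_right)
      also have "\<dots> \<le> 1 * (cmod (coord \<xi> i))\<^sup>2"
        using True by (intro mult_right_mono sq) (auto intro: action_closed)
      finally show ?thesis by simp
    qed (auto simp: i coord_fop g)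
  qed
  finally have "(norm (average G X \<phi> m s g a \<xi>))\<^sup>2 \<le> (norm a * norm \<xi>)\<^sup>2"
    by (simp add: power_mult_distrib mult_left_mono)
  thus "norm (average G X \<phi> m s g a \<xi>) \<le> norm a * norm \<xi>"
    by (rule power2_le_imp_le) simp
qed simp

text \<open>Conjugation by a translation fixes a constant, so only the sum of the squared weights
  remains. A nonconstant function would be replaced by different translates in different
  summands.\<close>

lemma average_const:
  assumes s: "\<And>j. j < m \<Longrightarrow> s j \<in> carrier G" and g: "\<And>j. j < m \<Longrightarrow> g j \<in> cfuns X"
    and sq: "\<And>x. x \<in> topspace X \<Longrightarrow> (\<Sum>j<m. (g j x)\<^sup>2) = 1"
  shows "average G X \<phi> m s g (fop (\<lambda>_. c)) = fop (\<lambda>_. c)"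
proof (rule blinfun_eqI, rule ell2_eqI)
  fix \<xi> and i :: "'g \<times> 'x"
  obtain t x where i: "i = (t, x)" by fastforce
  show "coord (average G X \<phi> m s g (fop (\<lambda>_. c)) \<xi>) i = coord (fop (\<lambda>_. c) \<xi>) i"
  proof (cases "t \<in> carrier G \<and> x \<in> topspace X")
    case True
    have cancel: "r \<otimes> (inv r \<otimes> t) = t" if "r \<in> carrier G" for r
      using that True by (simp add: m_assoc[symmetric])
    have "coord (average G X \<phi> m s g (fop (\<lambda>_. c)) \<xi>) i
        = (\<Sum>j<m. (g j (\<phi> t x))\<^sup>2 * (c * coord \<xi> i))"
      using True
      by (auto simp: average_def blinfun.sum_left coord_sum coord_fop coord_lop g i adj_lop s cancel
          power2_eq_square intro!: sum.cong)
    also have "\<dots> = c * coord \<xi> i"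
      using True by (simp add: sum_distrib_right[symmetric] sq action_closed)
    finally show ?thesis using True by (simp add: i coord_fop)
  qed (auto simp: average_def blinfun.sum_left coord_sum coord_fop g i)
qed

text \<open>Conjugation turns \<open>t\<close> into
  \<open>s j \<otimes> t \<otimes> inv s j\<close>, so row \<open>r\<close> meets column
  \<open>s j \<otimes> inv t \<otimes> inv s j \<otimes> r\<close>. The left weight is evaluated at
  the row and the right weight at the column.\<close>

lemma coord_average_crossed_sum:
  assumes s: "\<And>j. j < m \<Longrightarrow> s j \<in> carrier G" and g: "\<And>j. j < m \<Longrightarrow> g j \<in> cfuns X"
    and K: "K \<subseteq> carrier G" and f: "\<And>t. t \<in> K \<Longrightarrow> f t \<in> cfuns X"
    and rx: "r \<in> carrier G" "x \<in> topspace X"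
  shows "coord (average G X \<phi> m s g (\<Sum>t\<in>K. fop (f t) o\<^sub>L lop t) \<xi>) (r, x) =
    (\<Sum>j<m. \<Sum>t\<in>K. g j (\<phi> r x) * f t (\<phi> (inv s j \<otimes> r) x) *
      g j (\<phi> (s j \<otimes> (inv t \<otimes> (inv s j \<otimes> r))) x) * coord \<xi> (s j \<otimes> (inv t \<otimes> (inv s j \<otimes> r)), x))"
proof -
  have tK: "t \<in> carrier G" if "t \<in> K" for t using that K by blast
  show ?thesis
    using rx
    by (simp add: average_def blinfun.sum_left[of _ "{..<m}"] coord_sum coord_fop g s coord_lop adj_lop
        coord_crossed_sum[OF K f] tK sum_distrib_left mult.assoc)
qed

lemma average_outside:
  assumes g: "\<And>j. j < m \<Longrightarrow> g j \<in> cfuns X" and "\<not> (r \<in> carrier G \<and> x \<in> topspace X)"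
  shows "coord (average G X \<phi> m s g a \<xi>) (r, x) = 0"
  using assms by (auto simp: average_def blinfun.sum_left coord_sum coord_fop)

text \<open>The reduced crossed product is the closure of the finite sums, so a closed condition may
  be tested on these. Conditions on single coordinates are closed because coordinates of
  \<open>a v\<close> depend continuously on \<open>a\<close>.\<close>

lemma crossed_product_closed_induct:
  assumes a: "a \<in> reduced_crossed_product G X \<phi>" and "closed {a. P a}"
    and "\<And>K f. finite K \<Longrightarrow> K \<subseteq> carrier G \<Longrightarrow> (\<And>t. t \<in> K \<Longrightarrow> f t \<in> cfuns X) \<Longrightarrow>
      P (\<Sum>t\<in>K. fop (f t) o\<^sub>L lop t)"
  shows "P a"
proof -
  have "reduced_crossed_product G X \<phi> \<subseteq> {a. P a}"
    unfolding reduced_crossed_product_def crossed_span_def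
    by (rule closure_minimal) (use assms in blast)+
  thus ?thesis using a by blast
qed

lemma crossed_product_approx:
  assumes "a \<in> reduced_crossed_product G X \<phi>" "0 < \<epsilon>"
  obtains K f where "finite K" "K \<subseteq> carrier G" "\<And>t. t \<in> K \<Longrightarrow> f t \<in> cfuns X"
    "norm (a - (\<Sum>t\<in>K. fop (f t) o\<^sub>L lop t)) < \<epsilon>"
proof -
  have "\<exists>d\<in>{\<Sum>t\<in>K. fop (f t) o\<^sub>L lop t | K f.
      finite K \<and> K \<subseteq> carrier G \<and> (\<forall>t\<in>K. f t \<in> cfuns X)}. dist d a < \<epsilon>"
    using assms unfolding reduced_crossed_product_def crossed_span_def closure_approachable by blast
  then obtain K f where "finite K" "K \<subseteq> carrier G" "\<And>t. t \<in> K \<Longrightarrow> f t \<in> cfuns X"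
    "dist (\<Sum>t\<in>K. fop (f t) o\<^sub>L lop t) a < \<epsilon>"
    by blast
  thus ?thesis using that[of K f] by (simp add: dist_norm norm_minus_commute)
qed

lemma continuous_on_coord_apply: "continuous_on UNIV (\<lambda>a :: 'i operator. coord (a v) i)"
  using bounded_linear_compose[OF bounded_linear_coord[of i] blinfun.bounded_linear_left[of v]]
  by (simp add: linear_continuous_on o_def)

text \<open>The ambient operators are merely real-linear; this supplies the hypothesis under which
  \<open>adj_op\<close> is a genuine adjoint.\<close>

lemma crossed_product_complex_linear:
  assumes "a \<in> reduced_crossed_product G X \<phi>"
  shows "a (cscale c \<xi>) = cscale c (a \<xi>)"
proof -
  have "\<forall>i. coord (a (cscale c \<xi>)) i = c * coord (a \<xi>) i"
    using assms
  proof (rule crossed_product_closed_induct)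
    show "closed {a :: ('g \<times> 'x) operator. \<forall>i. coord (blinfun_apply a (cscale c \<xi>)) i = c * coord (a \<xi>) i}"
      by (intro closed_Collect_all closed_Collect_eq continuous_on_mult_left continuous_on_coord_apply)
  qed (auto simp: coord_crossed_sum coord_cscale sum_distrib_left mult_ac)
  thus ?thesis by (auto intro!: ell2_eqI simp: coord_cscale)
qed

text \<open>\<open>fop (\<lambda>_. 1)\<close> is the projection onto families supported on
  \<open>carrier G \<times> topspace X\<close>. The two identities say that elements of the crossed
  product have their range there and ignore everything outside.\<close>

lemma crossed_product_unit:
  assumes "a \<in> reduced_crossed_product G X \<phi>"
  shows "fop (\<lambda>_. 1) o\<^sub>L a = a" "a o\<^sub>L fop (\<lambda>_. 1) = a"
proof -
  have "\<forall>\<xi> t x. \<not> (t \<in> carrier G \<and> x \<in> topspace X) \<longrightarrow> coord (a \<xi>) (t, x) = 0"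
    using assms
  proof (rule crossed_product_closed_induct)
    show "closed {a :: ('g \<times> 'x) operator. \<forall>\<xi> t x. \<not> (t \<in> carrier G \<and> x \<in> topspace X) \<longrightarrow>
        coord (a \<xi>) (t, x) = 0}"
      by (intro closed_Collect_all closed_Collect_imp open_Collect_const closed_Collect_eq
          continuous_on_coord_apply continuous_on_const)
  qed (auto simp: coord_crossed_sum)
  thus "fop (\<lambda>_. 1) o\<^sub>L a = a"
    by (intro blinfun_eqI ell2_eqI) (auto simp: coord_fop)
  have "\<forall>\<xi> i. coord (a (fop (\<lambda>_. 1) \<xi>)) i = coord (a \<xi>) i"
    using assms
  proof (rule crossed_product_closed_induct)
    show "closed {a :: ('g \<times> 'x) operator. \<forall>\<xi> i. coord (blinfun_apply a (fop (\<lambda>_. 1) \<xi>)) i = coord (a \<xi>) i}"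
      by (intro closed_Collect_all closed_Collect_eq continuous_on_coord_apply)
  qed (auto simp: coord_crossed_sum coord_fop subset_eq intro!: sum.cong)
  thus "a o\<^sub>L fop (\<lambda>_. 1) = a"
    by (intro blinfun_eqI ell2_eqI) auto
qed

text \<open>The generators are invariant under replacing (t, x) by (t u^-1, u x) in both matrix
  indices, and u = t moves the entry to the identity. Hence a nonzero diagonal entry anywhere is
  visible in the expectation.\<close>

lemma diagonal_coord_eq_cond_exp:
  assumes "a \<in> reduced_crossed_product G X \<phi>" and t: "t \<in> carrier G" and x: "x \<in> topspace X"
  shows "coord (a (ket (t, x))) (t, x) = cond_exp G a (\<phi> t x)"
  unfolding cond_exp_def
  using assms(1)
proof (rule crossed_product_closed_induct)
  show "closed {a :: ('g \<times> 'x) operator. coord (blinfun_apply a (ket (t, x))) (t, x) =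
      coord (a (ket (\<one>, \<phi> t x))) (\<one>, \<phi> t x)}"
    by (intro closed_Collect_eq continuous_on_coord_apply)
next
  fix K f assume K: "finite K" "K \<subseteq> carrier G" and f: "\<And>t. t \<in> K \<Longrightarrow> f t \<in> cfuns X"
  have e: "inv s \<otimes> t = t \<longleftrightarrow> inv s = \<one>" if "s \<in> K" for s
    using that K t by (auto simp: subset_eq)
  show "coord ((\<Sum>s\<in>K. fop (f s) o\<^sub>L lop s) (ket (t, x))) (t, x) =
      coord ((\<Sum>s\<in>K. fop (f s) o\<^sub>L lop s) (ket (\<one>, \<phi> t x))) (\<one>, \<phi> t x)"
    using K t x
    by (auto simp: coord_crossed_sum[OF K(2) f] coord_ket action_closed action_one e subset_eq
        intro!: sum.cong)
qed

lemma lop_ket: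
  assumes "s \<in> carrier G" "x \<in> topspace X"
  shows "lop s (ket (\<one>, x)) = ket (s, x)"
proof (rule ell2_eqI)
  fix i :: "'g \<times> 'x"
  obtain t y where i: "i = (t, y)" by fastforce
  have "inv s \<otimes> t = \<one> \<longleftrightarrow> t = s" if "t \<in> carrier G"
    using that assms by (metis inv_closed inv_equality inv_inv l_inv)
  thus "coord (lop s (ket (\<one>, x))) i = coord (ket (s, x)) i"
    using assms by (auto simp: i coord_lop coord_ket)
qed

end

section \<open>Averaging over an extension\<close>

locale equivariant_map =
  X: topological_dynamics G X \<phi> + Y: topological_dynamics G Y \<psi>
  for G :: "('g, 'm) monoid_scheme" (structure)
    and X :: "'x topology" and \<phi> and Y :: "'y topology" and \<psi> +
  fixes \<pi> :: "'x \<Rightarrow> 'y"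
  assumes cont: "continuous_map X Y \<pi>"
    and equivariant: "s \<in> carrier G \<Longrightarrow> x \<in> topspace X \<Longrightarrow> \<pi> (\<phi> s x) = \<psi> s (\<pi> x)"
begin

lemma map_closed: "x \<in> topspace X \<Longrightarrow> \<pi> x \<in> topspace Y"
  using cont by (auto simp: continuous_map_def)

lemma pullback_real_in_cfuns:
  assumes "continuous_map Y euclideanreal g"
  shows "(\<lambda>x. complex_of_real (g (\<pi> x))) \<in> cfuns X" "(\<lambda>y. complex_of_real (g y)) \<in> cfuns Y"
proof -
  have "continuous_map euclidean euclidean complex_of_real"
    by (auto intro!: continuous_intros)
  from continuous_map_compose[OF assms this]
  have *: "continuous_map Y euclidean (\<lambda>y. complex_of_real (g y))" by (simp add: o_def)
  from continuous_map_compose[OF cont this] *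
  show "(\<lambda>x. complex_of_real (g (\<pi> x))) \<in> cfuns X" "(\<lambda>y. complex_of_real (g y)) \<in> cfuns Y"
    by (simp_all add: cfuns_def o_def)
qed

text \<open>Since the weights \<open>g j\<close> are nonnegative, the matrix of the average of \<open>\<Sum>t. f t \<lambda>(t)\<close> is
  dominated entrywise by that of the average of \<open>\<Sum>t. c t \<lambda>(t)\<close>, an element over \<open>Y\<close>.\<close>

lemma norm_average_crossed_sum_le:
  assumes K: "K \<subseteq> carrier G" and f: "\<And>t. t \<in> K \<Longrightarrow> f t \<in> cfuns X"
    and c: "\<And>t x. t \<in> K \<Longrightarrow> x \<in> topspace X \<Longrightarrow> cmod (f t x) \<le> c t"
    and s: "\<And>j. j < m \<Longrightarrow> s j \<in> carrier G"
    and g: "\<And>j. j < m \<Longrightarrow> continuous_map Y euclideanreal (g j)"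
    and g0: "\<And>j y. j < m \<Longrightarrow> y \<in> topspace Y \<Longrightarrow> 0 \<le> g j y"
  shows "norm (average G X \<phi> m s (\<lambda>j x. complex_of_real (g j (\<pi> x))) (\<Sum>t\<in>K. X.fop (f t) o\<^sub>L X.lop t))
    \<le> norm (average G Y \<psi> m s (\<lambda>j y. complex_of_real (g j y))
        (\<Sum>t\<in>K. Y.fop (\<lambda>_. complex_of_real (c t)) o\<^sub>L Y.lop t))"
    (is "norm ?T \<le> norm ?S")
proof (rule norm_le_of_fibrewise_domination[where p = \<pi>])
  fix \<xi> r x
  show "cmod (coord (?T \<xi>) (r, x)) \<le> cmod (coord (?S (fibre_vec (\<pi> x) x \<xi>)) (r, \<pi> x))"
  proof (cases "r \<in> carrier G \<and> x \<in> topspace X")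
    case True
    let ?w = "\<lambda>j t. s j \<otimes> (inv t \<otimes> (inv s j \<otimes> r))"
    have w: "?w j t \<in> carrier G" "inv s j \<otimes> r \<in> carrier G" if "j < m" "t \<in> K" for j t
      using that K s True by (auto simp: subset_eq)
    have cT: "coord (?T \<xi>) (r, x) = (\<Sum>j<m. \<Sum>t\<in>K.
        complex_of_real (g j (\<pi> (\<phi> r x))) * f t (\<phi> (inv s j \<otimes> r) x) *
        complex_of_real (g j (\<pi> (\<phi> (?w j t) x))) * coord \<xi> (?w j t, x))"
      using True by (intro X.coord_average_crossed_sum) (auto intro: s f pullback_real_in_cfuns g K[THEN subsetD])
    have cS: "coord (?S (fibre_vec (\<pi> x) x \<xi>)) (r, \<pi> x) = (\<Sum>j<m. \<Sum>t\<in>K.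
        complex_of_real (g j (\<psi> r (\<pi> x))) * complex_of_real (c t) *
        complex_of_real (g j (\<psi> (?w j t) (\<pi> x))) * coord (fibre_vec (\<pi> x) x \<xi>) (?w j t, \<pi> x))"
      using True by (intro Y.coord_average_crossed_sum)
        (auto intro: s f pullback_real_in_cfuns g map_closed K[THEN subsetD])
    have "cmod (coord (?T \<xi>) (r, x)) \<le> (\<Sum>j<m. \<Sum>t\<in>K.
        g j (\<psi> r (\<pi> x)) * c t * g j (\<psi> (?w j t) (\<pi> x)) * cmod (coord \<xi> (?w j t, x)))"
      unfolding cT
    proof (intro sum_norm_le)
      fix j t assume "j \<in> {..<m}" and t: "t \<in> K"
      hence j: "j < m" by simp
      \<comment> \<open>Nonnegativity enters here: taking moduli leaves the weights unchanged, so
        the bound is again an average with the same weights.\<close>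
      have "0 \<le> g j (\<psi> r (\<pi> x))" "0 \<le> g j (\<psi> (?w j t) (\<pi> x))"
        using True w[OF j t] j by (auto intro!: g0 Y.action_closed map_closed)
      moreover have "cmod (f t (\<phi> (inv s j \<otimes> r) x)) \<le> c t"
        using True w[OF j t] t by (auto intro!: c X.action_closed)
      ultimately show "cmod (complex_of_real (g j (\<pi> (\<phi> r x))) * f t (\<phi> (inv s j \<otimes> r) x) *
          complex_of_real (g j (\<pi> (\<phi> (?w j t) x))) * coord \<xi> (?w j t, x))
          \<le> g j (\<psi> r (\<pi> x)) * c t * g j (\<psi> (?w j t) (\<pi> x)) * cmod (coord \<xi> (?w j t, x))"
        using True w[OF j t]
        by (auto simp: norm_mult equivariant intro!: mult_right_mono mult_left_mono)
    qed
    \<comment> \<open>Over Y all terms are nonnegative reals, so nothing cancels and the sum of the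
      bounds is the coordinate itself.\<close>
    also have "\<dots> = Re (coord (?S (fibre_vec (\<pi> x) x \<xi>)) (r, \<pi> x))"
      unfolding cS by (simp add: coord_fibre_vec)
    also have "\<dots> \<le> cmod (coord (?S (fibre_vec (\<pi> x) x \<xi>)) (r, \<pi> x))"
      by (rule complex_Re_le_cmod)
    finally show ?thesis .
  next
    case False
    thus ?thesis by (subst X.average_outside) (auto intro: pullback_real_in_cfuns g)
  qed
qed

text \<open>Plumpness is applied to the element over Y with constant coefficients
  \<open>c t\<close>, where \<open>c t\<close> bounds \<open>f t\<close>. The weights and group
  elements obtained for it then serve over X after pullback along \<open>\<pi>\<close>.\<close>

lemma plump_average_small:
  assumes plump: "plump G Y \<psi> H" and H: "H \<subseteq> carrier G"
    and K: "finite K" "K \<subseteq> carrier G - {\<one>}" and f: "\<And>t. t \<in> K \<Longrightarrow> f t \<in> cfuns X"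
    and "0 < \<epsilon>"
  obtains m s g where "\<And>j. j < m \<Longrightarrow> s j \<in> H" "\<And>j. j < m \<Longrightarrow> continuous_map Y euclideanreal (g j)"
    "\<And>y. y \<in> topspace Y \<Longrightarrow> (\<Sum>j<m. (g j y)\<^sup>2) = 1"
    "norm (average G X \<phi> m s (\<lambda>j x. complex_of_real (g j (\<pi> x))) (\<Sum>t\<in>K. X.fop (f t) o\<^sub>L X.lop t)) < \<epsilon>"
proof -
  have "compact_space X" using X.Gamma_space by (simp add: Gamma_space_def)
  hence "\<exists>B. \<forall>x\<in>topspace X. cmod (f t x) \<le> B" if "t \<in> K" for t
    using cfuns_bounded[OF _ f[OF that]] by metis
  then obtain c where c: "\<And>t x. t \<in> K \<Longrightarrow> x \<in> topspace X \<Longrightarrow> cmod (f t x) \<le> c t"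
    by metis
  define b where "b = (\<Sum>t\<in>K. Y.fop (\<lambda>_. complex_of_real (c t)) o\<^sub>L Y.lop t)"
  have "b \<in> reduced_crossed_product G Y \<psi>"
    unfolding reduced_crossed_product_def crossed_span_def b_def
    by (rule subsetD[OF closure_subset]) (use K in \<open>auto intro!: exI[of _ K]\<close>)
  then obtain m s g where sg: "\<And>j. j < m \<Longrightarrow> s j \<in> H \<and> continuous_map Y euclideanreal (g j) \<and>
        (\<forall>y\<in>topspace Y. 0 \<le> g j y)"
      and sq: "\<And>y. y \<in> topspace Y \<Longrightarrow> (\<Sum>j<m. (g j y)\<^sup>2) = 1"
      and small: "norm (average G Y \<psi> m s (\<lambda>j y. complex_of_real (g j y)) b - Y.fop (cond_exp G b)) < \<epsilon>"
    using plump \<open>0 < \<epsilon>\<close> unfolding plump_def average_def by blast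
  have "cond_exp G b y = 0" if "y \<in> topspace Y" for y
    unfolding b_def using that K by (subst Y.cond_exp_crossed_sum) auto
  \<comment> \<open>\<open>cond_exp G b\<close> is known to vanish only on
    \<open>topspace Y\<close>; this suffices because \<open>Y.fop\<close> never evaluates it
    elsewhere.\<close>
  hence "coord (Y.fop (cond_exp G b) \<xi>) (t, y) = 0" for \<xi> t y
    using coord_fun_op[OF Y.group_action_axioms, of "cond_exp G b" 0 \<xi> t y] Y.action_closed[of t y] by simp
  hence "Y.fop (cond_exp G b) = 0"
    by (intro blinfun_eqI ell2_eqI) (auto simp: coord_zero)
  hence "norm (average G Y \<psi> m s (\<lambda>j y. complex_of_real (g j y)) b) < \<epsilon>" using small by simp
  moreover have "norm (average G X \<phi> m s (\<lambda>j x. complex_of_real (g j (\<pi> x))) (\<Sum>t\<in>K. X.fop (f t) o\<^sub>L X.lop t))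
      \<le> norm (average G Y \<psi> m s (\<lambda>j y. complex_of_real (g j y)) b)"
    unfolding b_def by (rule norm_average_crossed_sum_le) (use K f c sg H in auto)
  ultimately show ?thesis using sg sq by (intro that[of m s g]) auto
qed

end

section \<open>Ideals\<close>

lemma cscale_op_of_real: "cscale_op (complex_of_real r) T = r *\<^sub>R T"
  by (rule blinfun_eqI) (simp add: cscale_op_apply scaleR_eq_cscale blinfun.scaleR_left)

lemma complex_subspace_scaleR:
  assumes "complex_subspace A" "a \<in> A"
  shows "r *\<^sub>R a \<in> A"
  using assms unfolding complex_subspace_def cscale_op_of_real[symmetric] by blast

lemma complex_subspace_diff:
  assumes "complex_subspace A" "a \<in> A" "b \<in> A"
  shows "a - b \<in> A"
proof -
  have "a + (-1) *\<^sub>R b \<in> A"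
    using assms complex_subspace_scaleR[OF assms(1,3)] unfolding complex_subspace_def by blast
  thus ?thesis by simp
qed

lemma complex_subspace_sum:
  assumes "complex_subspace A" "\<And>j. j \<in> J \<Longrightarrow> f j \<in> A"
  shows "(\<Sum>j\<in>J. f j) \<in> A"
  using assms by (induction J rule: infinite_finite_induct) (auto simp: complex_subspace_def)

text \<open>The partial products \<open>w n = (e - u)\<^sup>n\<close> tend to \<open>0\<close> and are congruent to \<open>e\<close> modulo
  the ideal.\<close>

lemma closed_ideal_eq_of_almost_unit:
  assumes I: "closed_ideal I A" and A: "cstar_algebra A" and eA: "e \<in> A"
    and unit: "\<And>a. a \<in> A \<Longrightarrow> e o\<^sub>L a = a" "\<And>a. a \<in> A \<Longrightarrow> a o\<^sub>L e = a"
    and u: "u \<in> I" and small: "norm (e - u) < 1"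
  shows "I = A"
proof -
  have IA: "I \<subseteq> A" and csI: "complex_subspace I" and clI: "closed I"
    and ideal: "\<And>a b. a \<in> A \<Longrightarrow> b \<in> I \<Longrightarrow> a o\<^sub>L b \<in> I" "\<And>a b. a \<in> A \<Longrightarrow> b \<in> I \<Longrightarrow> b o\<^sub>L a \<in> I"
    using I unfolding closed_ideal_def by auto
  have csA: "complex_subspace A" and mulA: "\<And>a b. a \<in> A \<Longrightarrow> b \<in> A \<Longrightarrow> a o\<^sub>L b \<in> A"
    using A unfolding cstar_algebra_def by auto
  \<comment> \<open>The powers start at \<open>e\<close>, the unit of \<open>A\<close>, which may be
    a proper projection rather than the identity operator.\<close>
  define w where "w = (\<lambda>n. ((\<lambda>x. x o\<^sub>L (e - u)) ^^ n) e)"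
  have w0: "w 0 = e" and wS: "w (Suc n) = w n o\<^sub>L (e - u)" for n
    by (simp_all add: w_def)
  have wA: "w n \<in> A" for n
    using u IA by (induction n) (auto simp: w0 wS eA intro!: mulA complex_subspace_diff[OF csA])
  have wI: "e - w n \<in> I" for n
  proof (induction n)
    case 0
    show ?case using csI by (simp add: w0 complex_subspace_def)
  next
    case (Suc n)
    have "e - w (Suc n) = (e - w n) + (w n o\<^sub>L u)"
      unfolding wS
      by (simp add: bounded_bilinear.diff_right[OF bounded_bilinear_blinfun_compose] unit(2)[OF wA])
    moreover have "(e - w n) + (w n o\<^sub>L u) \<in> I"
      using Suc ideal(1)[OF wA u] csI by (simp add: complex_subspace_def)
    ultimately show ?case by metis
  qed
  have wn: "norm (w n) \<le> norm e * norm (e - u) ^ n" for n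
  proof (induction n)
    case (Suc n)
    have "norm (w (Suc n)) \<le> norm (w n) * norm (e - u)"
      unfolding wS by (rule norm_blinfun_compose)
    also have "\<dots> \<le> (norm e * norm (e - u) ^ n) * norm (e - u)"
      by (intro mult_right_mono Suc) simp
    finally show ?case by (simp add: mult_ac)
  qed (simp add: w0)
  have "(\<lambda>n. norm e * norm (e - u) ^ n) \<longlonglongrightarrow> norm e * 0"
    by (intro tendsto_mult_left LIMSEQ_realpow_zero) (use small in auto)
  hence "w \<longlonglongrightarrow> 0"
    by (intro Lim_null_comparison[of w "\<lambda>n. norm e * norm (e - u) ^ n"] always_eventually) (auto simp: wn)
  hence "(\<lambda>n. e - w n) \<longlonglongrightarrow> e - 0" by (intro tendsto_diff tendsto_const)
  hence eI: "e \<in> I" using closed_sequentially[OF clI, of "\<lambda>n. e - w n"] wI by simp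
  have "a \<in> I" if "a \<in> A" for a
    using ideal(1)[OF that eI] unit(2)[OF that] by simp
  thus ?thesis using IA by blast
qed

text \<open>Complex linearity carries the ket expansion through \<open>T\<close>. A real-linear
  operator, such as taking imaginary parts of coordinates, can kill every ket without being
  0.\<close>

lemma complex_linear_nonzero_ket:
  fixes T :: "'i operator"
  assumes lin: "\<And>c \<xi>. T (cscale c \<xi>) = cscale c (T \<xi>)" and "T \<noteq> 0"
  obtains i where "T (ket i) \<noteq> 0"
proof (rule ccontr)
  assume "\<not> thesis"
  hence z: "T (ket i) = 0" for i using that by blast
  have cz: "cscale c (0 :: 'i ell2) = 0" for c
    by (rule ell2_eqI) (simp add: coord_cscale coord_zero)
  have "T \<xi> = 0" for \<xi>
  proof -
    have "((\<lambda>i. T (cscale (coord \<xi> i) (ket i))) has_sum T \<xi>) UNIV"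
      using has_sum_bounded_linear[OF blinfun.bounded_linear_right[of T] has_sum_ket_expansion[of \<xi>]]
      by (simp add: o_def)
    hence "((\<lambda>i :: 'i. 0) has_sum T \<xi>) UNIV" by (simp add: lin z cz)
    thus ?thesis by (metis infsumI infsum_0_simp)
  qed
  thus False using \<open>T \<noteq> 0\<close> by (auto intro: blinfun_eqI)
qed

text \<open>Every dense orbit meets \<open>U\<close>, so the preimages of \<open>U\<close> under
  elements of \<open>H\<close> form an open cover, and compactness makes it finite.\<close>

lemma minimal_action_finite_cover:
  assumes X: "Gamma_space G X \<phi>" and H: "H \<subseteq> carrier G"
    and minimal: "minimal_action (G\<lparr>carrier := H\<rparr>) X \<phi>"
    and U: "openin X U" "U \<noteq> {}"
  obtains S where "finite S" "S \<subseteq> H" "\<And>x. x \<in> topspace X \<Longrightarrow> \<exists>s\<in>S. \<phi> s x \<in> U"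
proof -
  let ?V = "\<lambda>s. {x \<in> topspace X. \<phi> s x \<in> U}"
  have op: "openin X (?V s)" if "s \<in> H" for s
  proof -
    have "continuous_map X X (\<phi> s)"
      using X H that by (auto simp: Gamma_space_def intro: homeomorphic_imp_continuous_map)
    thus ?thesis using U(1) by (rule openin_continuous_map_preimage)
  qed
  have cover: "topspace X \<subseteq> \<Union>(?V ` H)"
  proof
    fix x assume x: "x \<in> topspace X"
    obtain z where z: "z \<in> U" using U(2) by blast
    have "z \<in> X closure_of (orbit (G\<lparr>carrier := H\<rparr>) \<phi> x)"
      using minimal x z openin_subset[OF U(1)] unfolding minimal_action_def by blast
    then obtain s where "s \<in> H" "\<phi> s x \<in> U"
      using z U(1) unfolding in_closure_of orbit_def by auto
    thus "x \<in> \<Union>(?V ` H)" using x by blast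
  qed
  have "compactin X (topspace X)" using X by (simp add: Gamma_space_def compact_space_def)
  then obtain F where F: "finite F" "F \<subseteq> ?V ` H" "topspace X \<subseteq> \<Union>F"
    using compactinD[of X "topspace X" "?V ` H"] cover op by blast
  obtain S where "S \<subseteq> H" "finite S" "F = ?V ` S"
    using finite_subset_image[OF F(1,2)] by blast
  thus ?thesis using F(3) by (intro that[of S]) auto
qed

section \<open>Averages of elements with expectation bounded below\<close>

context equivariant_map
begin

text \<open>Split \<open>a\<close> into a function \<open>f1\<close> near its expectation, an
  off-diagonal finite sum \<open>R\<close>, and an error. The function is handled by contractivity
  and the bounds \<eta> \<le> h \<le> \<open>norm a\<close>, the sum \<open>R\<close> by
  plumpness.\<close>

lemma average_near_scalar:
  assumes plump: "plump G Y \<psi> H" and H: "H \<subseteq> carrier G"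
    and a: "a \<in> reduced_crossed_product G X \<phi>" and "0 < \<eta>"
    and h: "\<And>x. x \<in> topspace X \<Longrightarrow> cond_exp G a x = complex_of_real (h x)"
      "\<And>x. x \<in> topspace X \<Longrightarrow> \<eta> \<le> h x"
  obtains m s g where "\<And>j. j < m \<Longrightarrow> s j \<in> H" "\<And>j. j < m \<Longrightarrow> continuous_map Y euclideanreal (g j)"
    "norm (norm a *\<^sub>R X.fop (\<lambda>_. 1) - average G X \<phi> m s (\<lambda>j x. complex_of_real (g j (\<pi> x))) a) < norm a"
proof -
  have hM: "h x \<le> norm a" if "x \<in> topspace X" for x
    using cmod_cond_exp_le[of G a x] h[OF that] \<open>0 < \<eta>\<close> by simp
  obtain x0 where "x0 \<in> topspace X" using X.Gamma_space unfolding Gamma_space_def by blast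
  hence M: "\<eta> \<le> norm a" using h(2) hM by force
  \<comment> \<open>With \<eta>/4, the diagonal part contributes at most \<open>norm a\<close> -
    3\<eta>/4, and the off-diagonal part and the error less than \<eta>/4 each, so the total stays
    below \<open>norm a\<close> - \<eta>/4.\<close>
  obtain K f where K: "finite K" "K \<subseteq> carrier G" and f: "\<And>t. t \<in> K \<Longrightarrow> f t \<in> cfuns X"
    and near: "norm (a - (\<Sum>t\<in>K. X.fop (f t) o\<^sub>L X.lop t)) < \<eta> / 4"
    using X.crossed_product_approx[OF a, of "\<eta> / 4"] \<open>0 < \<eta>\<close> by auto
  define d where "d = (\<Sum>t\<in>K. X.fop (f t) o\<^sub>L X.lop t)"
  define f1 where "f1 = (\<lambda>x. if \<one> \<in> K then f \<one> x else 0)"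
  define R where "R = (\<Sum>t\<in>K - {\<one>}. X.fop (f t) o\<^sub>L X.lop t)"
  have f1c: "f1 \<in> cfuns X" using f by (cases "\<one> \<in> K") (auto simp: f1_def)
  have f1M: "(\<lambda>x. complex_of_real (norm a) - f1 x) \<in> cfuns X"
    using f1c unfolding cfuns_def by (auto intro!: continuous_map_diff)
  have f1h: "cmod (complex_of_real (h x) - f1 x) \<le> \<eta> / 4" if x: "x \<in> topspace X" for x
  proof -
    have "cond_exp G d x = f1 x"
      unfolding d_def f1_def by (rule X.cond_exp_crossed_sum[OF K(2,1) f x])
    hence "complex_of_real (h x) - f1 x = cond_exp G (a - d) x"
      by (simp add: h(1)[OF x, symmetric] cond_exp_def blinfun.diff_left coord_minus)
    thus ?thesis using cmod_cond_exp_le[of G "a - d" x] near by (simp add: d_def)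
  qed
  have d_split: "d = X.fop f1 + R"
  proof (cases "\<one> \<in> K")
    case True
    \<comment> \<open>\<open>X.lop \<one>\<close> is only the projection onto supported families;
      \<open>X.fop f'\<close> absorbs it.\<close>
    have one: "X.fop f' o\<^sub>L X.lop \<one> = X.fop f'" if "f' \<in> cfuns X" for f'
      by (rule blinfun_eqI, rule ell2_eqI) (auto simp: X.coord_fop X.coord_lop that split: prod.splits)
    have "f1 = f \<one>" using True by (simp add: f1_def)
    thus ?thesis
      unfolding d_def R_def using sum.remove[OF K(1) True, of "\<lambda>t. X.fop (f t) o\<^sub>L X.lop t"] one f True
      by simp
  next
    case False
    have "X.fop f1 = 0"
      by (rule blinfun_eqI, rule ell2_eqI)
        (use False f1c in \<open>auto simp: X.coord_fop f1_def coord_zero split: prod.splits\<close>)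
    thus ?thesis using False by (simp add: d_def R_def)
  qed
  have offdiag: "finite (K - {\<one>})" "K - {\<one>} \<subseteq> carrier G - {\<one>}"
    "\<And>t. t \<in> K - {\<one>} \<Longrightarrow> f t \<in> cfuns X" "0 < \<eta> / 4"
    using K f \<open>0 < \<eta>\<close> by auto
  obtain m s g where s: "\<And>j. j < m \<Longrightarrow> s j \<in> H"
    and g: "\<And>j. j < m \<Longrightarrow> continuous_map Y euclideanreal (g j)"
    and sq: "\<And>y. y \<in> topspace Y \<Longrightarrow> (\<Sum>j<m. (g j y)\<^sup>2) = 1"
    and Rsmall: "norm (average G X \<phi> m s (\<lambda>j x. complex_of_real (g j (\<pi> x))) R) < \<eta> / 4"
    using plump_average_small[where K = "K - {\<one>}" and f = f, OF plump H offdiag, folded R_def] by blast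
  let ?g = "\<lambda>j x. complex_of_real (g j (\<pi> x))"
  let ?av = "average G X \<phi> m s ?g"
  have sG: "s j \<in> carrier G" if "j < m" for j using s[OF that] H by blast
  have gc: "?g j \<in> cfuns X" if "j < m" for j using pullback_real_in_cfuns g[OF that] by blast
  have sqX: "(\<Sum>j<m. (?g j x)\<^sup>2) = 1" if "x \<in> topspace X" for x
    using sq[OF map_closed[OF that]] by (simp flip: of_real_power of_real_sum)
  have sqX': "(\<Sum>j<m. (cmod (?g j x))\<^sup>2) \<le> 1" if "x \<in> topspace X" for x
    using sq[OF map_closed[OF that]] by simp
  have contr: "norm (?av b) \<le> norm b" for b
    by (rule X.norm_average_le[OF sG gc sqX'])
  have const: "?av (X.fop (\<lambda>_. complex_of_real (norm a))) = X.fop (\<lambda>_. complex_of_real (norm a))"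
    by (rule X.average_const[OF sG gc sqX])
  have scal: "norm a *\<^sub>R X.fop (\<lambda>_. 1) = X.fop (\<lambda>_. complex_of_real (norm a))"
    by (rule blinfun_eqI, rule ell2_eqI)
      (auto simp: X.coord_fop blinfun.scaleR_left coord_scaleR split: prod.splits)
  have fdiff: "X.fop (\<lambda>_. complex_of_real (norm a)) - X.fop f1 = X.fop (\<lambda>x. complex_of_real (norm a) - f1 x)"
    by (rule blinfun_eqI, rule ell2_eqI)
      (auto simp: X.coord_fop f1c f1M blinfun.diff_left coord_minus algebra_simps split: prod.splits)
  have "norm (X.fop (\<lambda>x. complex_of_real (norm a) - f1 x)) \<le> norm a - 3 * \<eta> / 4"
  proof (rule X.norm_fop_le[OF f1M])
    fix x assume x: "x \<in> topspace X"
    have "cmod (complex_of_real (norm a) - f1 x)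
        \<le> cmod (complex_of_real (norm a) - complex_of_real (h x)) + cmod (complex_of_real (h x) - f1 x)"
      using norm_triangle_ineq[of "complex_of_real (norm a) - complex_of_real (h x)" "complex_of_real (h x) - f1 x"]
      by simp
    also have "cmod (complex_of_real (norm a) - complex_of_real (h x)) = norm a - h x"
      using hM[OF x] by (simp flip: of_real_diff)
    finally show "cmod (complex_of_real (norm a) - f1 x) \<le> norm a - 3 * \<eta> / 4"
      using f1h[OF x] h(2)[OF x] by simp
  qed (use M \<open>0 < \<eta>\<close> in simp)
  hence n1: "norm (?av (X.fop (\<lambda>x. complex_of_real (norm a) - f1 x))) \<le> norm a - 3 * \<eta> / 4"
    using contr order_trans by blast
  have n3: "norm (?av (a - d)) < \<eta> / 4"
    using contr[of "a - d"] near by (simp add: d_def)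
  \<comment> \<open>The scalar is replaced by its own average, so that the difference becomes the
    average of \<open>norm a\<close> - \<open>f1\<close> - \<open>R\<close> - (\<open>a\<close> -
    \<open>d\<close>).\<close>
  have decomp: "norm a *\<^sub>R X.fop (\<lambda>_. 1) - ?av a
      = ?av (X.fop (\<lambda>x. complex_of_real (norm a) - f1 x)) - ?av R - ?av (a - d)"
    unfolding scal by (subst const[symmetric]) (simp add: average_diff[symmetric] fdiff[symmetric] d_split)
  have "norm (norm a *\<^sub>R X.fop (\<lambda>_. 1) - ?av a)
      \<le> norm (?av (X.fop (\<lambda>x. complex_of_real (norm a) - f1 x))) + norm (?av R) + norm (?av (a - d))"
    unfolding decomp
    using norm_triangle_ineq4[of "?av (X.fop (\<lambda>x. complex_of_real (norm a) - f1 x)) - ?av R" "?av (a - d)"]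
      norm_triangle_ineq4[of "?av (X.fop (\<lambda>x. complex_of_real (norm a) - f1 x))" "?av R"]
    by linarith
  hence "norm (norm a *\<^sub>R X.fop (\<lambda>_. 1) - ?av a) < norm a"
    using n1 n3 Rsmall \<open>0 < \<eta>\<close> by linarith
  thus ?thesis using s g by (intro that[of m s g])
qed

end

text \<open>The translations and pulled-back weights used in averaging thus belong to every
  intermediate algebra, so averages of elements of an ideal stay in the ideal.\<close>

lemma embedded_crossed_product_generators:
  assumes "equivariant_map G X \<phi> Y \<psi> \<pi>" and H: "subgroup H G"
  shows "s \<in> H \<Longrightarrow> lambda_op G X s \<in> embedded_crossed_product G X \<phi> Y \<pi> H"
    and "continuous_map Y euclideanreal g \<Longrightarrow>
      fun_op G X \<phi> (\<lambda>x. complex_of_real (g (\<pi> x))) \<in> embedded_crossed_product G X \<phi> Y \<pi> H"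
proof -
  interpret equivariant_map G X \<phi> Y \<psi> \<pi> by fact
  have gen: "X.fop (f \<circ> \<pi>) o\<^sub>L X.lop s \<in> embedded_crossed_product G X \<phi> Y \<pi> H"
    if "f \<in> cfuns Y" "s \<in> H" for f s
    unfolding embedded_crossed_product_def crossed_span_def
    by (rule subsetD[OF closure_subset])
      (use that in \<open>auto intro!: exI[of _ "{s}"] exI[of _ "\<lambda>_. f \<circ> \<pi>"]\<close>)
  show "X.lop s \<in> embedded_crossed_product G X \<phi> Y \<pi> H" if s: "s \<in> H"
  proof -
    have "X.fop ((\<lambda>_. 1) \<circ> \<pi>) o\<^sub>L X.lop s = X.lop s"
      by (rule blinfun_eqI, rule ell2_eqI)
        (use subgroup.subset[OF H] s in \<open>auto simp: o_def X.coord_fop X.coord_lop split: prod.splits\<close>)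
    thus ?thesis using gen[OF Y.const_in_cfuns s, of 1] by simp
  qed
  assume g: "continuous_map Y euclideanreal g"
  have "X.fop (\<lambda>x. complex_of_real (g (\<pi> x))) o\<^sub>L X.lop \<one>\<^bsub>G\<^esub> = X.fop (\<lambda>x. complex_of_real (g (\<pi> x)))"
    by (rule blinfun_eqI, rule ell2_eqI)
      (use pullback_real_in_cfuns(1)[OF g] in \<open>auto simp: X.coord_fop X.coord_lop split: prod.splits\<close>)
  thus "X.fop (\<lambda>x. complex_of_real (g (\<pi> x))) \<in> embedded_crossed_product G X \<phi> Y \<pi> H"
    using gen[OF pullback_real_in_cfuns(2)[OF g] subgroup.one_closed[OF H]] by (simp add: o_def)
qed

theorem theorem3:
  fixes G :: "('g, 'm) monoid_scheme"
    and X :: "'x topology" and \<phi> :: "'g \<Rightarrow> 'x \<Rightarrow> 'x"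
    and Y :: "'y topology" and \<psi> :: "'g \<Rightarrow> 'y \<Rightarrow> 'y"
    and \<pi> :: "'x \<Rightarrow> 'y" and H :: "'g set"
    and A :: "('g \<times> 'x) operator set"
  assumes "group G"
    and "Gamma_space G X \<phi>" and "Gamma_space G Y \<psi>"
    and "continuous_map X Y \<pi>" and "\<pi> ` topspace X = topspace Y"
    and "\<And>s x. s \<in> carrier G \<Longrightarrow> x \<in> topspace X \<Longrightarrow> \<pi> (\<phi> s x) = \<psi> s (\<pi> x)"
    and "subgroup H G"
    and "minimal_action (G\<lparr>carrier := H\<rparr>) X \<phi>"
    and "plump G Y \<psi> H"
    and "cstar_algebra A"
    and "embedded_crossed_product G X \<phi> Y \<pi> H \<subseteq> A"
    and "A \<subseteq> reduced_crossed_product G X \<phi>"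
  shows "simple_cstar_algebra A"
proof -
  have em: "equivariant_map G X \<phi> Y \<psi> \<pi>" by unfold_locales (use assms in auto)
  interpret equivariant_map G X \<phi> Y \<psi> \<pi> by (rule em)
  let ?e = "X.fop (\<lambda>_. 1)"
  have HG: "H \<subseteq> carrier G" using subgroup.subset[OF assms(7)] .
  have lA: "X.lop s \<in> A" if "s \<in> H" for s
    using embedded_crossed_product_generators(1)[OF em assms(7) that] assms(11) by blast
  have gA: "X.fop (\<lambda>x. complex_of_real (g (\<pi> x))) \<in> A" if "continuous_map Y euclideanreal g" for g
    using embedded_crossed_product_generators(2)[OF em assms(7) that] assms(11) by blast
  have eA: "?e \<in> A" using gA[of "\<lambda>_. 1"] by simp
  have mulA: "b o\<^sub>L c \<in> A" if "b \<in> A" "c \<in> A" for b c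
    using assms(10) that unfolding cstar_algebra_def by blast
  have adjA: "adj_op b \<in> A" if "b \<in> A" for b using assms(10) that unfolding cstar_algebra_def by blast
  note cp = assms(12)[THEN subsetD]
  note unit = X.crossed_product_unit[OF cp]
  note lin = X.crossed_product_complex_linear[OF cp]
  have "A \<noteq> {0}"
  proof
    assume "A = {0}"
    hence e0: "?e = 0" using eA by blast
    obtain x where x: "x \<in> topspace X" using assms(2) unfolding Gamma_space_def by blast
    have "coord (?e (ket (\<one>\<^bsub>G\<^esub>, x))) (\<one>\<^bsub>G\<^esub>, x) = 1" using x by (simp add: X.coord_fop coord_ket)
    thus False unfolding e0 by (simp add: coord_zero)
  qed
  moreover have "I = A" if I: "closed_ideal I A" and "I \<noteq> {0}" for I
  proof -
    have IA: "I \<subseteq> A" and csI: "complex_subspace I"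
      and idl: "\<And>b c. b \<in> A \<Longrightarrow> c \<in> I \<Longrightarrow> b o\<^sub>L c \<in> I" and idr: "\<And>b c. b \<in> A \<Longrightarrow> c \<in> I \<Longrightarrow> c o\<^sub>L b \<in> I"
      using I unfolding closed_ideal_def by auto
    obtain c where c: "c \<in> I" "c \<noteq> 0"
      using \<open>I \<noteq> {0}\<close> csI by (auto simp: complex_subspace_def)
    have cA: "c \<in> A" using c IA by blast
    define a where "a = adj_op c o\<^sub>L c"
    have aI: "a \<in> I" unfolding a_def by (rule idl[OF adjA[OF cA] c(1)])
    have acp: "a \<in> reduced_crossed_product G X \<phi>" using aI IA cp by blast
    define h where "h = (\<lambda>x. (norm (c (ket (\<one>\<^bsub>G\<^esub>, x))))\<^sup>2)"
    have diag: "coord (a (ket i)) i = complex_of_real ((norm (c (ket i)))\<^sup>2)" for i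
      unfolding a_def using coord_adj_op_self[of c i] lin[OF cA] by simp
    have Ea: "cond_exp G a x = complex_of_real (h x)" for x
      by (simp add: cond_exp_def diag h_def)
    obtain i where "c (ket i) \<noteq> 0"
      using complex_linear_nonzero_ket[of c] lin[OF cA] c(2) by blast
    obtain t x where tx: "c (ket (t, x)) \<noteq> 0" using \<open>c (ket i) \<noteq> 0\<close> by (cases i) auto
    have in_supp: "t \<in> carrier G \<and> x \<in> topspace X"
    \<comment> \<open>Since \<open>c\<close> equals \<open>c o\<^sub>L ?e\<close>, it kills every
      ket that \<open>?e\<close> kills.\<close>
    proof (rule ccontr)
      assume "\<not> (t \<in> carrier G \<and> x \<in> topspace X)"
      hence "?e (ket (t, x)) = 0"
        by (intro ell2_eqI) (auto simp: X.coord_fop coord_ket coord_zero split: prod.splits)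
      hence "c (ket (t, x)) = 0"
        using unit(2)[OF cA] by (metis blinfun.zero_right blinfun_apply_blinfun_compose)
      thus False using tx by blast
    qed
    define x0 where "x0 = \<phi> t x"
    have x0: "x0 \<in> topspace X" using in_supp by (simp add: x0_def X.action_closed)
    \<comment> \<open>The quarter leaves room for two errors of size \<eta>:
      \<open>Re (f1 x0)\<close> is at least 3\<eta>, hence above the threshold 2\<eta> defining
      \<open>U\<close>, and on \<open>U\<close> the function \<open>h\<close> still exceeds
      \<eta>.\<close>
    define \<eta> where "\<eta> = h x0 / 4"
    have "complex_of_real (h x0) = complex_of_real ((norm (c (ket (t, x))))\<^sup>2)"
      using X.diagonal_coord_eq_cond_exp[OF acp, of t x] in_supp by (simp add: Ea x0_def diag)
    hence "h x0 = (norm (c (ket (t, x))))\<^sup>2" unfolding of_real_eq_iff .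
    hence "0 < \<eta>" using tx by (simp add: \<eta>_def)
    obtain K f where K: "finite K" "K \<subseteq> carrier G" and f: "\<And>t. t \<in> K \<Longrightarrow> f t \<in> cfuns X"
      and near: "norm (a - (\<Sum>t\<in>K. X.fop (f t) o\<^sub>L X.lop t)) < \<eta>"
      using X.crossed_product_approx[OF acp \<open>0 < \<eta>\<close>] by blast
    define f1 where "f1 = (\<lambda>x. if \<one>\<^bsub>G\<^esub> \<in> K then f \<one>\<^bsub>G\<^esub> x else 0)"
    have f1c: "f1 \<in> cfuns X" using f by (cases "\<one>\<^bsub>G\<^esub> \<in> K") (auto simp: f1_def)
    have f1h: "\<bar>h x - Re (f1 x)\<bar> \<le> \<eta>" if x: "x \<in> topspace X" for x
    proof -
      have "cond_exp G (\<Sum>t\<in>K. X.fop (f t) o\<^sub>L X.lop t) x = f1 x"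
        unfolding f1_def by (rule X.cond_exp_crossed_sum[OF K(2,1) f x])
      hence "complex_of_real (h x) - f1 x = cond_exp G (a - (\<Sum>t\<in>K. X.fop (f t) o\<^sub>L X.lop t)) x"
        by (simp add: Ea[symmetric] cond_exp_def blinfun.diff_left coord_minus)
      hence "cmod (complex_of_real (h x) - f1 x) \<le> \<eta>"
        using cmod_cond_exp_le[of G "a - (\<Sum>t\<in>K. X.fop (f t) o\<^sub>L X.lop t)" x] near by simp
      thus ?thesis using abs_Re_le_cmod[of "complex_of_real (h x) - f1 x"] by simp
    qed
    \<comment> \<open>\<open>f1\<close> replaces \<open>h\<close> because its continuity makes
      \<open>U\<close> open.\<close>
    define U where "U = {x \<in> topspace X. f1 x \<in> {z. 2 * \<eta> < Re z}}"
    have "openin X U"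
      unfolding U_def
      by (rule openin_continuous_map_preimage[of X euclidean])
        (use f1c in \<open>auto simp: cfuns_def open_halfspace_Re_gt\<close>)
    moreover have "x0 \<in> U"
    proof -
      have "2 * \<eta> < Re (f1 x0)" using f1h[OF x0] \<open>0 < \<eta>\<close> \<eta>_def by linarith
      thus ?thesis using x0 by (simp add: U_def)
    qed
    ultimately obtain S where S: "finite S" "S \<subseteq> H"
      and cover: "\<And>x. x \<in> topspace X \<Longrightarrow> \<exists>s\<in>S. \<phi> s x \<in> U"
      using minimal_action_finite_cover[OF assms(2) HG assms(8), of U] by blast
    \<comment> \<open>The inverse stands on the left so that the diagonal entry of a summand at the
      identity and \<open>x\<close> is that of \<open>a\<close> at (s, x), namely
      \<open>h (\<phi> s x)\<close>. At least one of these is large by the choice of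
      \<open>S\<close>, and the others are nonnegative.\<close>
    define b where "b = (\<Sum>s\<in>S. X.lop (inv\<^bsub>G\<^esub> s) o\<^sub>L a o\<^sub>L X.lop s)"
    have bI: "b \<in> I"
      unfolding b_def
      by (rule complex_subspace_sum[OF csI], rule idr[OF lA idl[OF lA aI]])
        (use S subgroup.m_inv_closed[OF assms(7)] in auto)
    have bcp: "b \<in> reduced_crossed_product G X \<phi>" using bI IA cp by blast
    define h' where "h' = (\<lambda>x. \<Sum>s\<in>S. h (\<phi> s x))"
    have Eb: "cond_exp G b x = complex_of_real (h' x)" if x: "x \<in> topspace X" for x
    proof -
      have "coord (X.lop (inv\<^bsub>G\<^esub> s) (a (X.lop s (ket (\<one>\<^bsub>G\<^esub>, x))))) (\<one>\<^bsub>G\<^esub>, x) = complex_of_real (h (\<phi> s x))"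
        if "s \<in> S" for s
        using that S HG x X.diagonal_coord_eq_cond_exp[OF acp, of s x]
        by (auto simp: X.lop_ket X.coord_lop subset_eq Ea)
      thus ?thesis by (simp add: cond_exp_def b_def blinfun.sum_left coord_sum h'_def)
    qed
    have h': "\<eta> \<le> h' x" if x: "x \<in> topspace X" for x
    proof -
      obtain s where s: "s \<in> S" "\<phi> s x \<in> U" using cover[OF x] by blast
      have "\<eta> \<le> h (\<phi> s x)" using s(2) f1h[of "\<phi> s x"] by (auto simp: U_def)
      also have "\<dots> \<le> h' x"
        unfolding h'_def using s S(1) by (intro member_le_sum) (auto simp: h_def)
      finally show ?thesis .
    qed
    obtain m s g where s: "\<And>j. j < m \<Longrightarrow> s j \<in> H"
      and g: "\<And>j. j < m \<Longrightarrow> continuous_map Y euclideanreal (g j)"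
      and close: "norm (norm b *\<^sub>R ?e - average G X \<phi> m s (\<lambda>j x. complex_of_real (g j (\<pi> x))) b) < norm b"
      using average_near_scalar[OF assms(9) HG bcp \<open>0 < \<eta>\<close> Eb h'] by blast
    let ?p = "average G X \<phi> m s (\<lambda>j x. complex_of_real (g j (\<pi> x))) b"
    have pI: "?p \<in> I"
      unfolding average_def
    proof (rule complex_subspace_sum[OF csI])
      fix j assume "j \<in> {..<m}"
      hence sj: "X.lop (s j) \<in> A" and gj: "X.fop (\<lambda>x. complex_of_real (g j (\<pi> x))) \<in> A"
        using lA s gA g by auto
      show "X.fop (\<lambda>x. complex_of_real (g j (\<pi> x))) o\<^sub>L X.lop (s j) o\<^sub>L b o\<^sub>L
          adj_op (X.lop (s j)) o\<^sub>L X.fop (\<lambda>x. complex_of_real (g j (\<pi> x))) \<in> I"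
        by (rule idr[OF gj idr[OF adjA[OF sj] idl[OF mulA[OF gj sj] bI]]])
    qed
    \<comment> \<open>A norm lies strictly below \<open>norm b\<close>, so \<open>b\<close> is
      nonzero and the average may be rescaled by \<open>1 / norm b\<close>.\<close>
    have b0: "0 < norm b" using close norm_ge_zero by (rule le_less_trans[rotated])
    have "?e - (1 / norm b) *\<^sub>R ?p = (1 / norm b) *\<^sub>R (norm b *\<^sub>R ?e - ?p)"
      using b0 by (simp add: scaleR_diff_right)
    hence "norm (?e - (1 / norm b) *\<^sub>R ?p) = norm (norm b *\<^sub>R ?e - ?p) / norm b"
      by (simp only: norm_scaleR abs_divide abs_one abs_norm_cancel times_divide_eq_left mult_1_left)
    also have "\<dots> < 1" using close b0 by (simp only: divide_less_eq_1_pos)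
    finally have "norm (?e - (1 / norm b) *\<^sub>R ?p) < 1" .
    thus "I = A"
      using closed_ideal_eq_of_almost_unit[OF I assms(10) eA unit complex_subspace_scaleR[OF csI pI]]
      by blast
  qed
  ultimately show ?thesis using assms(10) unfolding simple_cstar_algebra_def by blast
qed

end
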